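(* Let $n\geqslant 2$, and let $u_0\in\mathcal{C}^2_0(\mathbb{R}^n)$, $u_1\in\mathcal{C}^1_0(\mathbb{R}^n)$ be compactly supported functions with supports contained in $B_R$ for some $R>0$, with $$\int_{\mathbb{R}^n}u_1(x)\,\mathrm{d}x>0.$$ Let $\mu:[0,+\infty)\to[0,+\infty)$ be a modulus of continuity such that: (i) the function $g:\mathbb{R}\to[0,+\infty)$, $g(\tau)=|\tau|^{p_{\mathrm{Gla}}(n)}\mu(|\tau|)$, is convex; (ii) $\mu$ does not satisfy the Dini condition, i.e. $\int_0^{\tau_0}\frac{\mu(\tau)}{\tau}\,\mathrm{d}\tau=+\infty$ for some (and, then, for any) $\tau_0>0$. Introduce the decreasing function $$\mathcal{H}:(0,\tau_0]\to[0,+\infty),\qquad \mathcal{H}(\tau)=\int_\tau^{\tau_0}\frac{\mu(\sigma)}{\sigma}\,\mathrm{d}\sigma .$$ Then there exist $\varepsilon_0=\varepsilon_0(n,R,u_1)>0$ and positive constants $c_1,c_2,C$ independent of $\varepsilon$ such that for any $\varepsilon\in(0,\varepsilon_0]$ the lifespan $T_\varepsilon$ of the local (in time) classical solution $u\in\mathcal{C}^2([0,T_\varepsilon)\times\mathbb{R}^n)$ to the semilinear Cauchy problem $$\begin{cases}u_{tt}-\Delta u=|u_t|^{p_{\mathrm{Gla}}(n)}\mu(|u_t|),& x\in\mathbb{R}^n,\ t>0,\\ u(0,x)=\varepsilon u_0(x),\quad u_t(0,x)=\varepsilon u_1(x),& x\in\mathbb{R}^n,\end{cases}$$ satisfies the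 upper bound estimate $$T_\varepsilon\leqslant C\varepsilon^{\frac{2}{n-1}}\left[\mathcal{H}^{-1}\left(c_1\varepsilon^{-\frac{2}{n-1}}+\mathcal{H}(c_2\varepsilon)\right)\right]^{-\frac{2}{n-1}}.$$
   Context: The Glassey exponent is $p_{\mathrm{Gla}}(n):=\frac{n+1}{n-1}$ for $n\geqslant 2$. $B_R$ is the ball of $\mathbb{R}^n$ centred at the origin with radius $R$. A modulus of continuity is a continuous, concave and increasing function $\mu:[0,+\infty)\to[0,+\infty)$ with $\mu(0)=0$. The modulus of continuity $\mu$ satisfies the Dini condition if $\int_0^{\tau_0}\frac{\mu(\tau)}{\tau}\,\mathrm{d}\tau<+\infty$ for some (equivalently, for any) $\tau_0>0$. When the Dini condition fails, $\mathcal{H}:(0,\tau_0]\to[0,+\infty)$ is invertible, and $\mathcal{H}^{-1}:[0,+\infty)\to(0,\tau_0]$ denotes its inverse. The lifespan $T_\varepsilon$ of a local solution is its maximal existence time. *)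

theory Defs
  imports "HOL-Analysis.Analysis"
begin

text \<open>
  Derivatives are taken within the set. On \<open>[0,T) \<times> R^n\<close> this means that the derivatives are
  one-sided in time at \<open>t = 0\<close> and continuous up to \<open>t = 0\<close>.
\<close>

definition C1_on :: "'a::real_normed_vector set \<Rightarrow> ('a \<Rightarrow> 'b::real_normed_vector) \<Rightarrow> bool" where
  "C1_on S f \<longleftrightarrow>
     (\<exists>f' :: 'a \<Rightarrow> 'a \<Rightarrow>\<^sub>L 'b.
        (\<forall>z\<in>S. (f has_derivative blinfun_apply (f' z)) (at z within S)) \<and> continuous_on S f')"

definition C2_on :: "'a::real_normed_vector set \<Rightarrow> ('a \<Rightarrow> 'b::real_normed_vector) \<Rightarrow> bool" where
  "C2_on S f \<longleftrightarrow>
     (\<exists>f' :: 'a \<Rightarrow> 'a \<Rightarrow>\<^sub>L 'b.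
        (\<forall>z\<in>S. (f has_derivative blinfun_apply (f' z)) (at z within S)) \<and> C1_on S f')"

definition supp :: "('a::topological_space \<Rightarrow> 'b::zero) \<Rightarrow> 'a set" where
  "supp f = closure {x. f x \<noteq> 0}"

text \<open>
  Time derivative relative to the half-line \<open>[0,\<infinity>)\<close>: the usual derivative for \<open>t > 0\<close>,
  the right derivative at \<open>t = 0\<close>.
\<close>

definition dt :: "(real \<Rightarrow> 'a \<Rightarrow> real) \<Rightarrow> real \<Rightarrow> 'a \<Rightarrow> real" where
  "dt u t x = vector_derivative (\<lambda>s. u s x) (at t within {0..})"

definition dx :: "'n::finite \<Rightarrow> (real^'n \<Rightarrow> real) \<Rightarrow> real^'n \<Rightarrow> real" where
  "dx i f x = deriv (\<lambda>h. f (x + h *\<^sub>R axis i 1)) 0"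

definition laplacian :: "(real^'n \<Rightarrow> real) \<Rightarrow> real^'n \<Rightarrow> real" where
  "laplacian f x = (\<Sum>i\<in>UNIV. dx i (dx i f) x)"

text \<open>
  \<open>u\<close> is a classical solution on \<open>[0,T) \<times> R^n\<close> of \<open>u_tt - \<Delta>u = F(u_t)\<close> with
  \<open>u(0,\<cdot>) = f\<close> and \<open>u_t(0,\<cdot>) = g\<close>; the value \<open>T = \<infinity>\<close> (global solutions) is allowed.
\<close>

definition classical_solution ::
  "(real \<Rightarrow> real) \<Rightarrow> (real^'n \<Rightarrow> real) \<Rightarrow> (real^'n \<Rightarrow> real) \<Rightarrow> ereal \<Rightarrow> (real \<Rightarrow> real^'n \<Rightarrow> real) \<Rightarrow> bool"
where
  "classical_solution F f g T u \<longleftrightarrow>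
     C2_on ({t. 0 \<le> t \<and> ereal t < T} \<times> UNIV) (\<lambda>(t, x). u t x) \<and>
     (\<forall>t x. 0 < t \<and> ereal t < T \<longrightarrow> dt (dt u) t x - laplacian (u t) x = F (dt u t x)) \<and>
     (\<forall>x. u 0 x = f x) \<and>
     (\<forall>x. dt u 0 x = g x)"

text \<open>
  The maximal existence time. If there is no local classical solution at all, then this is
  \<open>Sup {} = -\<infinity>\<close>.
\<close>

definition lifespan ::
  "(real \<Rightarrow> real) \<Rightarrow> (real^'n \<Rightarrow> real) \<Rightarrow> (real^'n \<Rightarrow> real) \<Rightarrow> ereal"
where
  "lifespan F f g = Sup {T. 0 < T \<and> (\<exists>u. classical_solution F f g T u)}"

definition p_Gla :: "nat \<Rightarrow> real" where
  "p_Gla n = (real n + 1) / (real n - 1)"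

text \<open>Only the values of \<open>\<mu>\<close> on \<open>[0,\<infinity>)\<close> matter; \<open>increasing\<close> is understood in the weak sense.\<close>

definition modulus_of_continuity :: "(real \<Rightarrow> real) \<Rightarrow> bool" where
  "modulus_of_continuity \<mu> \<longleftrightarrow>
     (\<forall>\<tau>\<ge>0. 0 \<le> \<mu> \<tau>) \<and> \<mu> 0 = 0 \<and>
     continuous_on {0..} \<mu> \<and> concave_on {0..} \<mu> \<and> mono_on {0..} \<mu>"

definition dini_condition :: "(real \<Rightarrow> real) \<Rightarrow> bool" where
  "dini_condition \<mu> \<longleftrightarrow>
     (\<exists>\<tau>\<^sub>0>0. (\<integral>\<^sup>+\<tau>\<in>{0<..\<tau>\<^sub>0}. ennreal (\<mu> \<tau> / \<tau>) \<partial>lborel) < \<infinity>)"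

definition nonlinearity :: "nat \<Rightarrow> (real \<Rightarrow> real) \<Rightarrow> real \<Rightarrow> real" where
  "nonlinearity n \<mu> \<tau> = \<bar>\<tau>\<bar> powr p_Gla n * \<mu> \<bar>\<tau>\<bar>"

definition H :: "(real \<Rightarrow> real) \<Rightarrow> real \<Rightarrow> real \<Rightarrow> real" where
  "H \<mu> \<tau>\<^sub>0 \<tau> = integral {\<tau>..\<tau>\<^sub>0} (\<lambda>\<sigma>. \<mu> \<sigma> / \<sigma>)"

definition H_inv :: "(real \<Rightarrow> real) \<Rightarrow> real \<Rightarrow> real \<Rightarrow> real" where
  "H_inv \<mu> \<tau>\<^sub>0 = the_inv_into {0<..\<tau>\<^sub>0} (H \<mu> \<tau>\<^sub>0)"

end

theory Submission
  imports Defs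
begin

text \<open>
  The argument reduces the problem to one space dimension and then to an ordinary differential
  inequality. Fix a coordinate direction \<open>k\<close>. Along an outgoing line \<open>x$k = t + z\<close> the quantity
  \<open>u_t - u_k\<close>, integrated over the remaining coordinates, changes at a rate given by the integrated
  nonlinearity. Instead of slicing \<open>R^n\<close> into hyperplanes, one averages over \<open>z\<close> as well, with a
  \<open>C^1\<close> cutoff \<open>\<psi>\<close> that is 1 on \<open>[-R,\<infinity>)\<close> and 0 on \<open>(-\<infinity>,-3R]\<close>:
  \<open>Y(t) = \<integral>(u_t - u_k)(t,x) \<psi>(x$k - t) dx\<close> satisfies \<open>Y'(t) = \<integral>F(u_t) \<psi>(x$k - t) dx \<ge> 0\<close>, because the
  weight is a solution of the transport equation and all remaining terms are divergences
  (\<open>traveling_average_deriv\<close>). The support of the data makes \<open>\<psi> = 1\<close> wherever \<open>u\<close> lives at time 0,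
  so \<open>Y(0) = \<epsilon> \<integral>u1\<close>, the contribution of \<open>\<partial>_k u0\<close> integrating to 0. The same computation for
  \<open>u_t + u_k\<close> along incoming lines shows that \<open>\<integral>u_t \<psi> \<ge> Y/2\<close> after time \<open>2R\<close>.

  By finite speed of propagation the integrand lives, for \<open>t \<ge> 3R\<close>, in the intersection of \<open>|x| \<le> R + t\<close> with
  \<open>x$k \<ge> t - 3R\<close>, a set of volume at most \<open>m(t) = K t^((n-1)/2)\<close>. This is much less than \<open>t^n\<close>,
  and it is the reason why the Glassey exponent is the critical one: the convexity of \<open>F\<close>
  (Jensen's inequality) gives \<open>Y' \<ge> m F(Y/(2m))\<close>, and with \<open>F(v) = v^p \<mu>(v)\<close>, \<open>p - 1 = 2/(n-1)\<close>,
  the power of \<open>t\<close> is exactly \<open>t^(-1)\<close>: \<open>Y' \<ge> c t^(-1) Y^p \<mu>(\<sigma>(t))\<close>, where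
  \<open>\<sigma>(t) = \<epsilon> a t^(-(n-1)/2) / (2K)\<close> and \<open>a = \<integral>u1\<close> (\<open>outgoing_average_growth\<close>). Dividing by \<open>Y^p\<close> and
  integrating, the substitution \<open>\<sigma> = \<sigma>(t)\<close> turns \<open>\<integral>\<mu>(\<sigma>(t)) dt/t\<close> into a multiple of
  \<open>H(\<sigma>(T)) - H(\<sigma>(3R))\<close>, while \<open>Y^(1-p)\<close> is at most \<open>(\<epsilon> a)^(1-p)\<close>. Hence
  \<open>H(\<sigma>(T)) \<le> c1 \<epsilon>^(-2/(n-1)) + H(c2 \<epsilon>)\<close> for every existence time \<open>T \<ge> 3R\<close> (\<open>glassey_ode_bound\<close>), and
  solving for \<open>T\<close> gives the bound. The constants \<open>c1\<close>, \<open>c2\<close>, \<open>C\<close> may depend on \<open>\<mu>\<close> and \<open>\<tau>\<^sub>0\<close>, so that \<open>\<epsilon>\<^sub>0 = 1\<close> works: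
  the inequality \<open>c2 \<epsilon>\<^sub>0 \<le> \<tau>\<^sub>0\<close> is arranged by enlarging \<open>K\<close>.

  A classical solution is only assumed to be \<open>C^2\<close>, without any decay in \<open>x\<close>, so finite speed of
  propagation has to be derived first (\<open>finite_speed\<close>). It comes from an energy estimate with a \<open>C^1\<close>
  weight supported in a backward cone, which needs the divergence theorem only for compactly
  supported fields.
\<close>

section \<open>Integrals of divergences\<close>

text \<open>
  The divergence theorem is needed only for functions with bounded support, where it says that the
  integral of a partial derivative vanishes. A large fixed cube serves as domain of integration.
\<close>

abbreviation cube :: "real \<Rightarrow> (real^'n) set" where
  "cube N \<equiv> cbox (\<chi> i. - N) (\<chi> i. N)"

lemma norm_gt_if_notin_cube: "(x::real^'n) \<notin> cube N \<Longrightarrow> N < norm x"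
proof -
  assume "x \<notin> cube N"
  then obtain i where "x $ i < - N \<or> N < x $ i" by (auto simp: mem_box_cart not_le)
  then have "\<bar>x $ i\<bar> > N" by linarith
  with component_le_norm_cart[of x i] show ?thesis by linarith
qed

lemma integral_cbox_eq_UNIV:
  fixes f :: "real^'n \<Rightarrow> real"
  assumes "\<And>x. x \<notin> cbox a b \<Longrightarrow> f x = 0"
  shows "integral (cbox a b) f = integral UNIV f"
proof -
  have "(\<lambda>x. if x \<in> cbox a b then f x else 0) = f" using assms by auto
  then show ?thesis
    using Henstock_Kurzweil_Integration.integral_restrict_UNIV[of "cbox a b" f] by simp
qed

text \<open>
  By translation invariance \<open>\<integral>Q(x + h e) dx\<close> does not depend on \<open>h\<close>; differentiating under the
  integral sign at \<open>h = 0\<close> gives the claim. The gap between \<open>M\<close> and \<open>N\<close> leaves room for the shift.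
\<close>

lemma integral_partial_derivative_eq_0:
  fixes Q Q' :: "real^'n \<Rightarrow> real"
  assumes der: "\<And>x. ((\<lambda>h. Q (x + h *\<^sub>R e)) has_real_derivative Q' x) (at 0)"
    and cont: "continuous_on UNIV Q'" "continuous_on UNIV Q"
    and e: "norm e = 1"
    and supp: "\<And>x. norm x \<ge> M \<Longrightarrow> Q x = 0" and MN: "M < N"
  shows "integral (cube N) Q' = 0"
proof -
  define U where "U = {-(N - M)..N - M}"
  have der': "((\<lambda>h. Q (x + h *\<^sub>R e)) has_real_derivative Q' (x + h *\<^sub>R e)) (at h within U)" for x h
  proof -
    have "((\<lambda>k. Q ((x + h *\<^sub>R e) + k *\<^sub>R e)) has_real_derivative Q' (x + h *\<^sub>R e)) (at (h + - h))"
      using der[of "x + h *\<^sub>R e"] by simp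
    from DERIV_shift[THEN iffD1, OF this]
    have "((\<lambda>k. Q (x + k *\<^sub>R e)) has_real_derivative Q' (x + h *\<^sub>R e)) (at h)"
      by (simp add: algebra_simps)
    then show ?thesis by (rule has_field_derivative_at_within)
  qed
  have L: "((\<lambda>h. integral (cube N) (\<lambda>x. Q (x + h *\<^sub>R e))) has_real_derivative
          integral (cube N) (\<lambda>x. Q' (x + 0 *\<^sub>R e))) (at 0 within U)"
  proof (rule leibniz_rule_field_derivative[where fx = "\<lambda>h x. Q' (x + h *\<^sub>R e)"])
    show "(\<lambda>x. Q (x + h *\<^sub>R e)) integrable_on cube N" for h
      by (intro integrable_continuous continuous_on_compose2[OF cont(2)] continuous_intros) auto
    show "continuous_on (U \<times> cube N) (\<lambda>(h, x). Q' (x + h *\<^sub>R e))"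
      unfolding split_beta
      by (intro continuous_on_compose2[OF cont(1)] continuous_intros) auto
  qed (use MN der' in \<open>auto simp: U_def\<close>)
  have C: "integral (cube N) (\<lambda>x. Q (x + h *\<^sub>R e)) = integral (cube N) Q" if "h \<in> U" for h
  proof -
    let ?c = "h *\<^sub>R e"
    let ?a = "(\<chi> i. - N) :: real^'n" and ?b = "(\<chi> i. N) :: real^'n"
    have h: "norm ?c \<le> N - M" using that e by (auto simp: U_def)
    have "integral (cube N) (\<lambda>x. Q (x + ?c)) = integral UNIV (\<lambda>x. Q (x + ?c))"
    proof (rule integral_cbox_eq_UNIV)
      fix x :: "real^'n" assume "x \<notin> cube N"
      from norm_gt_if_notin_cube[OF this] h norm_triangle_ineq4[of "x + ?c" ?c]
      have "norm (x + ?c) \<ge> M" by simp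
      then show "Q (x + ?c) = 0" by (rule supp)
    qed
    also have "\<dots> = integral (cbox (?a - ?c) (?b - ?c)) (\<lambda>x. Q (x + ?c))"
    proof (rule integral_cbox_eq_UNIV[symmetric])
      fix x :: "real^'n" assume "x \<notin> cbox (?a - ?c) (?b - ?c)"
      then have "x + ?c \<notin> cube N" by (auto simp: mem_box_cart algebra_simps)
      from norm_gt_if_notin_cube[OF this] MN show "Q (x + ?c) = 0" by (intro supp) simp
    qed
    also have "\<dots> = integral (cube N) Q" by (rule integral_shift_cbox)
    finally show ?thesis .
  qed
  have "((\<lambda>h. integral (cube N) Q) has_real_derivative integral (cube N) Q') (at 0 within U)"
    using has_field_derivative_transform_within[OF L, of 1 "\<lambda>_. integral (cube N) Q"] C MN
    by (auto simp: U_def)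
  moreover have "((\<lambda>h. integral (cube N) Q) has_real_derivative 0) (at 0 within U)" by simp
  moreover have "at 0 within U \<noteq> bot"
    using MN by (auto simp: U_def trivial_limit_within intro!: islimpt_Icc[THEN iffD2])
  ultimately show ?thesis by (metis has_field_derivative_def DERIV_unique has_real_derivative_iff_has_vector_derivative vector_derivative_unique_within)
qed

text \<open>
  The balance law behind all the integral identities below: in the derivative of \<open>\<integral>P\<close> one may add the
  divergence of any flux \<open>Q\<close> of bounded support to \<open>P'\<close>. A good choice of \<open>Q\<close> removes the second
  space derivatives or turns them into \<open>F(u_t)\<close>.
\<close>

lemma flux_derivative:
  fixes P P' :: "real \<Rightarrow> real^'n \<Rightarrow> real" and Q Q' :: "'n \<Rightarrow> real \<Rightarrow> real^'n \<Rightarrow> real"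
  assumes P: "\<And>t x. t \<in> {0..b} \<Longrightarrow> ((\<lambda>s. P s x) has_real_derivative P' t x) (at t within {0..b})"
    and cP: "continuous_on ({0..b} \<times> UNIV) (\<lambda>z. P (fst z) (snd z))"
    and cP': "continuous_on ({0..b} \<times> UNIV) (\<lambda>z. P' (fst z) (snd z))"
    and Q: "\<And>i x. ((\<lambda>h. Q i t (x + h *\<^sub>R axis i 1)) has_real_derivative Q' i t x) (at 0)"
    and cQ: "\<And>i. continuous_on UNIV (Q i t)"
    and cQ': "\<And>i. continuous_on UNIV (Q' i t)"
    and supp: "\<And>i x. norm x \<ge> M \<Longrightarrow> Q i t x = 0" and MN: "M < N"
    and t: "t \<in> {0..b}"
  shows "((\<lambda>s. integral (cube N) (P s)) has_real_derivative
            integral (cube N) (\<lambda>x. P' t x + (\<Sum>i\<in>UNIV. Q' i t x))) (at t within {0..b})"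
proof -
  have slice: "continuous_on A (f s)" if "s \<in> {0..b}"
    "continuous_on ({0..b} \<times> UNIV) (\<lambda>z. f (fst z) (snd z))" for f :: "real \<Rightarrow> real^'n \<Rightarrow> real" and s A
    using continuous_on_compose2[OF that(2), of A "\<lambda>x. (s, x)"] that(1)
    by (auto simp: continuous_on_Pair image_subset_iff)
  have "((\<lambda>s. integral (cube N) (P s)) has_real_derivative integral (cube N) (P' t)) (at t within {0..b})"
  proof (rule leibniz_rule_field_derivative)
    show "P s integrable_on cube N" if "s \<in> {0..b}" for s
      using slice[OF that cP] by (intro integrable_continuous)
    show "continuous_on ({0..b} \<times> cube N) (\<lambda>(s, x). P' s x)"
      unfolding split_beta by (rule continuous_on_subset[OF cP']) auto
  qed (use P t in auto)
  moreover have "integral (cube N) (\<lambda>x. P' t x + (\<Sum>i\<in>UNIV. Q' i t x)) = integral (cube N) (P' t)"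
  proof -
    have int: "Q' i t integrable_on cube N" for i
      by (intro integrable_continuous continuous_on_subset[OF cQ']) auto
    have "integral (cube N) (Q' i t) = 0" for i
      by (rule integral_partial_derivative_eq_0[of "Q i t" "axis i 1"])
         (use Q cQ cQ' supp MN in auto)
    then have "integral (cube N) (\<lambda>x. \<Sum>i\<in>UNIV. Q' i t x) = 0"
      using int by (subst integral_sum) auto
    moreover have "(\<lambda>x. \<Sum>i\<in>UNIV. Q' i t x) integrable_on cube N"
      using int by (intro integrable_sum) auto
    moreover have "P' t integrable_on cube N"
      using slice[OF t cP'] by (intro integrable_continuous)
    ultimately show ?thesis by (subst integral_add) auto
  qed
  ultimately show ?thesis by simp
qed

lemma nonincreasing_if_deriv_nonpos:
  fixes f :: "real \<Rightarrow> real"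
  assumes "a \<le> b" and f: "\<And>t. t \<in> {a..b} \<Longrightarrow> (f has_real_derivative f' t) (at t within {a..b})"
    and "\<And>t. a < t \<Longrightarrow> t \<le> b \<Longrightarrow> f' t \<le> 0"
  shows "f b \<le> f a"
proof (rule DERIV_nonpos_imp_decreasing_open[OF assms(1)])
  show "continuous_on {a..b} f"
    by (rule DERIV_continuous_on[OF f])
  fix t assume t: "a < t" "t < b"
  then have "at t within {a..b} = at t" by (intro at_within_interior) auto
  with f[of t] assms(3)[of t] t show "\<exists>y. (f has_real_derivative y) (at t) \<and> y \<le> 0" by auto
qed

section \<open>Regularity of classical solutions\<close>

text \<open>
  The partial derivatives of a \<open>C^2\<close> solution on a compact time interval \<open>[0,b]\<close>, as separate functions:
  all the calculus below is done along coordinate lines. The use of one function \<open>uxt\<close> in both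
  \<open>ut_x\<close> and \<open>ux_t\<close> records the symmetry of the mixed derivatives.
\<close>

locale wave_solution =
  fixes b :: real and F :: "real \<Rightarrow> real" and u ut utt :: "real \<Rightarrow> real^'n \<Rightarrow> real"
    and ux uxt uxx :: "'n \<Rightarrow> real \<Rightarrow> real^'n \<Rightarrow> real"
  assumes b_pos: "0 < b"
    and u_t: "\<And>t x. t \<in> {0..b} \<Longrightarrow> ((\<lambda>s. u s x) has_real_derivative ut t x) (at t within {0..b})"
    and ut_t: "\<And>t x. t \<in> {0..b} \<Longrightarrow> ((\<lambda>s. ut s x) has_real_derivative utt t x) (at t within {0..b})"
    and ux_t: "\<And>i t x. t \<in> {0..b} \<Longrightarrow> ((\<lambda>s. ux i s x) has_real_derivative uxt i t x) (at t within {0..b})"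
    and u_x: "\<And>i t x. t \<in> {0..b} \<Longrightarrow> ((\<lambda>h. u t (x + h *\<^sub>R axis i 1)) has_real_derivative ux i t x) (at 0)"
    and ut_x: "\<And>i t x. t \<in> {0..b} \<Longrightarrow> ((\<lambda>h. ut t (x + h *\<^sub>R axis i 1)) has_real_derivative uxt i t x) (at 0)"
    and ux_x: "\<And>i t x. t \<in> {0..b} \<Longrightarrow> ((\<lambda>h. ux i t (x + h *\<^sub>R axis i 1)) has_real_derivative uxx i t x) (at 0)"
    and cont_u: "continuous_on ({0..b} \<times> UNIV) (\<lambda>z. u (fst z) (snd z))"
    and cont_ut: "continuous_on ({0..b} \<times> UNIV) (\<lambda>z. ut (fst z) (snd z))"
    and cont_ux: "\<And>i. continuous_on ({0..b} \<times> UNIV) (\<lambda>z. ux i (fst z) (snd z))"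
    and cont_utt: "continuous_on ({0..b} \<times> UNIV) (\<lambda>z. utt (fst z) (snd z))"
    and cont_uxt: "\<And>i. continuous_on ({0..b} \<times> UNIV) (\<lambda>z. uxt i (fst z) (snd z))"
    and cont_uxx: "\<And>i. continuous_on ({0..b} \<times> UNIV) (\<lambda>z. uxx i (fst z) (snd z))"
    and wave_eq: "\<And>t x. 0 < t \<Longrightarrow> t \<le> b \<Longrightarrow> utt t x - (\<Sum>i\<in>UNIV. uxx i t x) = F (ut t x)"

text \<open>
  Differentiate \<open>f(s,h) - f(s,0) = \<integral>\<^sub>0\<^sup>h fx(s,y) dy\<close> in \<open>s\<close> under the integral sign, then in \<open>h\<close> at
  \<open>h = 0\<close>. This works up to the boundary \<open>t = a\<close>, where the time derivative is one-sided.
\<close>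

lemma mixed_partials_eq:
  fixes f :: "real \<Rightarrow> real \<Rightarrow> real"
  assumes fx: "\<And>s y. s \<in> {a..b} \<Longrightarrow> y \<in> {0..1} \<Longrightarrow> (f s has_real_derivative fx s y) (at y within {0..1})"
    and ft: "\<And>y. y \<in> {0..1} \<Longrightarrow> ((\<lambda>s. f s y) has_real_derivative ft y) (at t within {a..b})"
    and fxt: "\<And>s y. s \<in> {a..b} \<Longrightarrow> y \<in> {0..1} \<Longrightarrow> ((\<lambda>s. fx s y) has_real_derivative fxt s y) (at s within {a..b})"
    and ftx: "(ft has_real_derivative ftx) (at 0 within {0..1})"
    and cont: "continuous_on ({a..b} \<times> {0..1}) (\<lambda>z. fxt (fst z) (snd z))"
    and t: "t \<in> {a..b}" "a < b"
  shows "ftx = fxt t 0"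
proof -
  have int: "(fx s has_integral f s h - f s 0) {0..h}" if "s \<in> {a..b}" "h \<in> {0..1}" for s h
    using that by (intro fundamental_theorem_of_calculus)
      (auto simp: has_real_derivative_iff_has_vector_derivative[symmetric]
        intro!: has_field_derivative_subset[OF fx])
  have cfxt: "continuous_on {0..1} (fxt t)"
    using continuous_on_compose2[OF cont, of "{0..1}" "\<lambda>y. (t, y)"] t
    by (auto simp: continuous_on_Pair image_subset_iff)
  have eq: "integral {0..h} (fxt t) = ft h - ft 0" if h: "h \<in> {0..1}" for h
  proof -
    have "((\<lambda>s. integral (cbox 0 h) (fx s)) has_real_derivative integral (cbox 0 h) (fxt t)) (at t within {a..b})"
    proof (rule leibniz_rule_field_derivative)
      show "continuous_on ({a..b} \<times> cbox 0 h) (\<lambda>(s, y). fxt s y)"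
        unfolding split_beta by (rule continuous_on_subset[OF cont]) (use h in auto)
      show "fx s integrable_on cbox 0 h" if "s \<in> {a..b}" for s
        using int[OF that h] by (auto intro: has_integral_integrable)
    qed (use h fxt t in auto)
    then have "((\<lambda>s. f s h - f s 0) has_real_derivative integral {0..h} (fxt t)) (at t within {a..b})"
      using has_field_derivative_transform_within[of "\<lambda>s. integral (cbox 0 h) (fx s)" _ t "{a..b}" 1 "\<lambda>s. f s h - f s 0"]
        t int h by (auto intro: integral_unique)
    moreover have "((\<lambda>s. f s h - f s 0) has_real_derivative ft h - ft 0) (at t within {a..b})"
      using h by (intro DERIV_diff ft) auto
    ultimately show ?thesis
      using t by (auto simp: has_real_derivative_iff_has_vector_derivative
        intro: vector_derivative_unique_within[rotated] simp: trivial_limit_within islimpt_Icc)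
  qed
  have "((\<lambda>h. integral {0..h} (fxt t)) has_real_derivative fxt t 0) (at 0 within {0..1})"
    by (rule integral_has_real_derivative[OF cfxt]) auto
  then have "((\<lambda>h. ft h - ft 0) has_real_derivative fxt t 0) (at 0 within {0..1})"
    by (rule has_field_derivative_transform_within[where d = 1]) (use eq in auto)
  moreover have "((\<lambda>h. ft h - ft 0) has_real_derivative ftx) (at 0 within {0..1})"
    using DERIV_diff[OF ftx DERIV_const, of "ft 0"] by simp
  ultimately show ?thesis
    by (auto simp: has_real_derivative_iff_has_vector_derivative
        intro: vector_derivative_unique_within[rotated] simp: trivial_limit_within islimpt_Icc)
qed

lemma C1_on_subset: "C1_on S f \<Longrightarrow> A \<subseteq> S \<Longrightarrow> C1_on A f"
  unfolding C1_on_def by (meson continuous_on_subset has_derivative_subset subsetD)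

lemma has_real_derivative_along_line:
  fixes f :: "'a::real_normed_vector \<Rightarrow> real"
  assumes "(f has_derivative f') (at (c h) within S)"
    and "\<And>k. c k = p + k *\<^sub>R v" "c ` A \<subseteq> S"
  shows "((\<lambda>k. f (c k)) has_real_derivative f' v) (at h within A)"
proof -
  have "((\<lambda>k. p + k *\<^sub>R v) has_derivative (\<lambda>k. k *\<^sub>R v)) (at h within A)"
    by (auto intro!: derivative_eq_intros)
  then have c: "(c has_derivative (\<lambda>k. k *\<^sub>R v)) (at h within A)"
    using assms(2) by presburger
  have "((\<lambda>k. f (c k)) has_derivative (\<lambda>k. f' (k *\<^sub>R v))) (at h within A)"
    by (rule has_derivative_in_compose[OF c has_derivative_subset[OF assms(1,3)]])
  moreover have "f' (k *\<^sub>R v) = f' v * k" for k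
    using linear_scale[OF has_derivative_linear[OF assms(1)]] by simp
  ultimately show ?thesis by (simp add: has_field_derivative_def fun_eq_iff mult_commute_abs)
qed

text \<open>
  The derivative of the Frechet derivative provides all second partial derivatives. An
  intermediate time \<open>c\<close> between \<open>b\<close> and \<open>T\<close> keeps \<open>b\<close> away from the end of the time interval, so that
  derivatives within \<open>[0,c)\<close> agree with those within \<open>[0,\<infinity>)\<close> in the definition of \<open>dt\<close>.
\<close>

lemma classical_solution_imp_wave_solution:
  fixes u :: "real \<Rightarrow> real^'n \<Rightarrow> real"
  assumes sol: "classical_solution F f g T u" and b: "0 < b" "ereal b < T"
  obtains ut utt ux uxt uxx where "wave_solution b F u ut utt ux uxt uxx" "ut 0 = g"
proof -
  obtain c where c: "b < c" "ereal c < T"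
    using ereal_dense2[OF b(2)] by auto
  define S where "S = {0..<c} \<times> (UNIV :: (real^'n) set)"
  have S_sub: "S \<subseteq> {t. 0 \<le> t \<and> ereal t < T} \<times> UNIV"
    using c(2) less_trans[of "ereal _" "ereal c" T] by (auto simp: S_def)
  have bS: "{0..b} \<times> UNIV \<subseteq> S" using c b by (auto simp: S_def)
  from sol obtain D0 where D0: "\<And>z. z \<in> {t. 0 \<le> t \<and> ereal t < T} \<times> UNIV \<Longrightarrow>
      ((\<lambda>(t, x). u t x) has_derivative blinfun_apply (D0 z)) (at z within {t. 0 \<le> t \<and> ereal t < T} \<times> UNIV)"
    and "C1_on ({t. 0 \<le> t \<and> ereal t < T} \<times> UNIV) D0"
    unfolding classical_solution_def C2_on_def by blast
  then have "C1_on S D0" using S_sub by (blast intro: C1_on_subset)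
  then obtain D2 where D2: "\<And>z. z \<in> S \<Longrightarrow> (D0 has_derivative blinfun_apply (D2 z)) (at z within S)"
    and cD2: "continuous_on S D2"
    unfolding C1_on_def by blast
  have D1: "((\<lambda>z. u (fst z) (snd z)) has_derivative blinfun_apply (D0 z)) (at z within S)" if "z \<in> S" for z
    using has_derivative_subset[OF D0 S_sub, of z] that S_sub unfolding split_beta by blast
  have cD0: "continuous_on S D0" by (rule has_derivative_continuous_on[OF D2])
  have cu: "continuous_on S (\<lambda>z. u (fst z) (snd z))" by (rule has_derivative_continuous_on[OF D1])
  have D2': "((\<lambda>z. D0 z w) has_derivative (\<lambda>v. D2 z v w)) (at z within S)" if "z \<in> S" for z w
    using bounded_linear.has_derivative[OF blinfun.bounded_linear_left D2[OF that]] .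

  define e :: "'n \<Rightarrow> real \<times> (real^'n)" where "e i = (0, axis i 1)" for i
  define d :: "real \<times> (real^'n)" where "d = (1, 0)"
  have time_line: "((\<lambda>s. k (s, x)) has_real_derivative k' d) (at t within A)"
    if "(k has_derivative k') (at (t, x) within S)" "A \<subseteq> {0..<c}" for k :: "_ \<Rightarrow> real" and k' t x A
    by (rule has_real_derivative_along_line[where c = "\<lambda>s. (s, x)" and p = "(0, x)", OF that(1)])
       (use that in \<open>auto simp: S_def d_def\<close>)
  have space_line: "((\<lambda>h. k (t, x + h *\<^sub>R axis i 1)) has_real_derivative k' (e i)) (at h)"
    if "(k has_derivative k') (at (t, x + h *\<^sub>R axis i 1) within S)" "t \<in> {0..<c}" for k :: "_ \<Rightarrow> real" and k' t x i h
    by (rule has_real_derivative_along_line[where c = "\<lambda>h. (t, x + h *\<^sub>R axis i 1)" and p = "(t, x)", OF that(1)])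
       (use that in \<open>auto simp: S_def e_def\<close>)
  define ut where "ut t x = D0 (t, x) d" for t x
  define ux where "ux i t x = D0 (t, x) (e i)" for i t x
  define utt where "utt t x = D2 (t, x) d d" for t x
  define uxt where "uxt i t x = D2 (t, x) d (e i)" for i t x
  define uxx where "uxx i t x = D2 (t, x) (e i) (e i)" for i t x
  have SI: "(t, x) \<in> S" if "t \<in> {0..<c}" for t x using that by (simp add: S_def)

  have u_t: "((\<lambda>s. u s x) has_real_derivative ut t x) (at t within A)" if "t \<in> {0..<c}" "A \<subseteq> {0..<c}" for t x A
    using time_line[OF D1[OF SI] that(2)] that(1) by (simp add: ut_def)
  have ut_t: "((\<lambda>s. ut s x) has_real_derivative utt t x) (at t within A)" if "t \<in> {0..<c}" "A \<subseteq> {0..<c}" for t x A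
    using time_line[OF D2'[OF SI] that(2)] that(1) by (simp add: ut_def utt_def)
  have ux_t: "((\<lambda>s. ux i s x) has_real_derivative uxt i t x) (at t within A)" if "t \<in> {0..<c}" "A \<subseteq> {0..<c}" for i t x A
    using time_line[OF D2'[OF SI] that(2)] that(1) by (simp add: ux_def uxt_def)
  have u_x: "((\<lambda>h. u t (x + h *\<^sub>R axis i 1)) has_real_derivative ux i t (x + h *\<^sub>R axis i 1)) (at h)" if "t \<in> {0..<c}" for i t x h
    using space_line[OF D1[OF SI] that] that by (simp add: ux_def)
  have ux_x: "((\<lambda>h. ux i t (x + h *\<^sub>R axis i 1)) has_real_derivative uxx i t (x + h *\<^sub>R axis i 1)) (at h)" if "t \<in> {0..<c}" for i t x h
    using space_line[OF D2'[OF SI] that] that by (simp add: ux_def uxx_def)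
  have ut_x0: "((\<lambda>h. ut t (x + h *\<^sub>R axis i 1)) has_real_derivative D2 (t, x + h *\<^sub>R axis i 1) (e i) d) (at h)" if "t \<in> {0..<c}" for i t x h
    using space_line[OF D2'[OF SI] that] that by (simp add: ut_def)

  have cont: "continuous_on S (\<lambda>z. ut (fst z) (snd z))" "continuous_on S (\<lambda>z. utt (fst z) (snd z))"
    "\<And>i. continuous_on S (\<lambda>z. ux i (fst z) (snd z))" "\<And>i. continuous_on S (\<lambda>z. uxt i (fst z) (snd z))"
    "\<And>i. continuous_on S (\<lambda>z. uxx i (fst z) (snd z))"
    unfolding ut_def utt_def ux_def uxt_def uxx_def prod.collapse
    by (intro continuous_intros cD0 cD2)+
  have mixed: "D2 (t, x) (e i) d = uxt i t x" if t: "t \<in> {0..b}" for i t x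
  proof -
    have "D2 (t, x) (e i) d = uxt i t (x + 0 *\<^sub>R axis i 1)"
    proof (rule mixed_partials_eq[where a = 0 and b = b and f = "\<lambda>s h. u s (x + h *\<^sub>R axis i 1)"
        and fx = "\<lambda>s h. ux i s (x + h *\<^sub>R axis i 1)" and ft = "\<lambda>h. ut t (x + h *\<^sub>R axis i 1)"
        and fxt = "\<lambda>s h. uxt i s (x + h *\<^sub>R axis i 1)"])
      show "((\<lambda>h. ut t (x + h *\<^sub>R axis i 1)) has_real_derivative D2 (t, x) (e i) d) (at 0 within {0..1})"
        using ut_x0[of t x i 0] t c by (auto intro: has_field_derivative_at_within)
      show "continuous_on ({0..b} \<times> {0..1}) (\<lambda>z. uxt i (fst z) (x + snd z *\<^sub>R axis i 1))"
      proof -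
        have "continuous_on ({0..b} \<times> {0..1}) (\<lambda>z. (fst z, x + snd z *\<^sub>R axis i 1))"
          by (intro continuous_intros)
        from continuous_on_compose2[OF cont(4)[of i] this] c show ?thesis
          by (auto simp: S_def image_subset_iff)
      qed
    qed (use t b c in \<open>auto intro!: u_x u_t ux_t has_field_derivative_at_within[OF u_x]\<close>)
    then show ?thesis by simp
  qed
  have dt_eq: "vector_derivative (\<lambda>s. v s) (at t within {0..}) = v'"
    if "(w has_real_derivative v') (at t within {0..<c})" "\<And>s. s \<in> {0..<c} \<Longrightarrow> v s = w s" "t \<in> {0..<c}"
    for v w :: "real \<Rightarrow> real" and t v'
  proof -
    have "(v has_vector_derivative v') (at t within {0..<c})"
      using has_field_derivative_transform_within[OF that(1), of 1 v] that(2,3)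
      by (auto simp: has_real_derivative_iff_has_vector_derivative)
    moreover have "at t within {0..<c} = at t within {0..}"
      using that(3) by (intro at_within_nhd[of _ "{..<c}"]) auto
    moreover have "at t within {0..} \<noteq> bot"
      using that(3) islimpt_subset[of t "{t..t + 1}" "{0..}"]
      by (auto simp: trivial_limit_within islimpt_Icc)
    ultimately show ?thesis using vector_derivative_within by metis
  qed
  have dt1: "dt u t x = ut t x" if "t \<in> {0..<c}" for t x
    unfolding dt_def by (rule dt_eq[OF u_t]) (use that in auto)
  have dt2: "dt (dt u) t x = utt t x" if "t \<in> {0..<c}" for t x
    unfolding dt_def[of "dt u"] by (rule dt_eq[OF ut_t]) (use that dt1 in auto)
  have dx1: "dx i (u t) = ux i t" if "t \<in> {0..<c}" for i t
    unfolding dx_def fun_eq_iff using u_x[OF that, where h = 0] by (auto intro!: DERIV_imp_deriv)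
  have dx2: "dx i (dx i (u t)) x = uxx i t x" if "t \<in> {0..<c}" for i t x
    unfolding dx1[OF that] unfolding dx_def using ux_x[OF that, where h = 0 and x = x] by (auto intro!: DERIV_imp_deriv)
  have bc: "{0..b} \<subseteq> {0..<c}" using c by auto
  have "wave_solution b F u ut utt ux uxt uxx"
  proof
    show "((\<lambda>h. ut t (x + h *\<^sub>R axis i 1)) has_real_derivative uxt i t x) (at 0)" if "t \<in> {0..b}" for t x i
      using ut_x0[of t x i 0] mixed[OF that] that c by auto
    show "utt t x - (\<Sum>i\<in>UNIV. uxx i t x) = F (ut t x)" if t: "0 < t" "t \<le> b" for t x
    proof -
      have "ereal t < T" using t c less_trans[of "ereal t" "ereal c" T] by auto
      with sol t have "dt (dt u) t x - laplacian (u t) x = F (dt u t x)"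
        by (auto simp: classical_solution_def)
      then show ?thesis using t c by (simp add: dt1 dt2 laplacian_def dx2)
    qed
  qed (use b c u_x[where h = 0] ux_x[where h = 0]
      in \<open>auto intro!: u_t[OF _ bc] ut_t[OF _ bc] ux_t[OF _ bc] continuous_on_subset[OF cont(1) bS] continuous_on_subset[OF cont(2) bS]
         continuous_on_subset[OF cont(3) bS] continuous_on_subset[OF cont(4) bS]
         continuous_on_subset[OF cont(5) bS] continuous_on_subset[OF cu bS]\<close>)
  moreover have "ut 0 = g"
    using sol dt1[of 0] b c by (auto simp: classical_solution_def fun_eq_iff)
  ultimately show ?thesis using that by blast
qed

section \<open>Finite speed of propagation\<close>

text \<open>
  The \<open>C^1\<close> building block of the cutoff functions; one continuous derivative is all they need.
\<close>

definition pos_sq :: "real \<Rightarrow> real" where "pos_sq s = (max 0 s)\<^sup>2"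

lemma pos_sq_nonneg [simp]: "0 \<le> pos_sq s"
  by (simp add: pos_sq_def)

lemma continuous_on_pos_sq [continuous_intros]:
  "continuous_on A f \<Longrightarrow> continuous_on A (\<lambda>x. pos_sq (f x))"
  unfolding pos_sq_def by (intro continuous_intros)

lemma has_real_derivative_pos_sq:
  "(pos_sq has_real_derivative 2 * max 0 s) (at s within A)"
proof -
  have "(pos_sq has_real_derivative 2 * max 0 s) (at s)"
  proof (cases s "0 :: real" rule: linorder_cases)
    case less
    have "((\<lambda>_. 0) has_real_derivative 2 * max 0 s) (at s)"
      using less by simp
    then show ?thesis
      by (rule has_field_derivative_transform_within_open[of _ _ _ "{..<0}"])
         (use less in \<open>auto simp: pos_sq_def\<close>)
  next
    case equal
    have "((\<lambda>h. pos_sq h / h) \<longlongrightarrow> 0) (at 0)"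
    proof (rule Lim_null_comparison)
      show "\<forall>\<^sub>F h in at 0. norm (pos_sq h / h) \<le> \<bar>h\<bar>"
        by (auto simp: pos_sq_def max_def power2_eq_square)
      show "((\<lambda>h::real. \<bar>h\<bar>) \<longlongrightarrow> 0) (at 0)"
        by (rule tendsto_rabs_zero) (rule tendsto_ident_at)
    qed
    then show ?thesis using equal by (simp add: DERIV_def pos_sq_def)
  next
    case greater
    have "((\<lambda>s. s\<^sup>2) has_real_derivative 2 * max 0 s) (at s)"
      using greater by (auto intro!: derivative_eq_intros)
    then show ?thesis
      by (rule has_field_derivative_transform_within_open[of _ _ _ "{0<..}"])
         (use greater in \<open>auto simp: pos_sq_def\<close>)
  qed
  then show ?thesis by (rule has_field_derivative_at_within)
qed

lemmas has_real_derivative_pos_sq_compose [derivative_intros] =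
  DERIV_chain2[OF has_real_derivative_pos_sq]

lemma norm_add_axis_sq:
  "(norm (y + h *\<^sub>R axis i 1 :: real^'n))\<^sup>2 = (norm y)\<^sup>2 + 2 * h * y $ i + h\<^sup>2"
  unfolding power2_norm_eq_inner
  by (simp add: inner_add_left inner_add_right inner_axis inner_axis' power2_eq_square algebra_simps)

context wave_solution
begin

lemma cont_slice:
  assumes "t \<in> {0..b}"
  shows "continuous_on A (u t)" "continuous_on A (ut t)" "continuous_on A (utt t)"
    "continuous_on A (ux i t)" "continuous_on A (uxt i t)" "continuous_on A (uxx i t)"
proof -
  have slice: "continuous_on A (f t)"
    if "continuous_on ({0..b} \<times> UNIV) (\<lambda>z. f (fst z) (snd z))" for f :: "real \<Rightarrow> real^'n \<Rightarrow> real"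
    using continuous_on_compose2[OF that, of A "\<lambda>x. (t, x)"] assms
    by (auto simp: continuous_on_Pair image_subset_iff)
  show "continuous_on A (u t)" "continuous_on A (ut t)" "continuous_on A (utt t)"
    "continuous_on A (ux i t)" "continuous_on A (uxt i t)" "continuous_on A (uxx i t)"
    by (rule slice cont_u cont_ut cont_utt cont_ux cont_uxt cont_uxx)+
qed

lemma ux_eq_0_on_open:
  assumes "open A" "\<And>x. x \<in> A \<Longrightarrow> u t x = 0" "x \<in> A" "t \<in> {0..b}"
  shows "ux i t x = 0"
proof -
  have "open ((\<lambda>h. x + h *\<^sub>R axis i 1) -` A)"
    by (intro continuous_open_vimage assms continuous_intros)
  moreover have "((\<lambda>h. 0) has_real_derivative 0) (at 0)" by simp
  ultimately have "((\<lambda>h. u t (x + h *\<^sub>R axis i 1)) has_real_derivative 0) (at 0)"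
    using assms by (elim has_field_derivative_transform_within_open[rotated]) auto
  then show ?thesis using u_x[OF assms(4)] DERIV_unique by blast
qed

text \<open>
  The energy density \<open>e = (u_t^2 + |\<nabla>u|^2)/2\<close> is weighted with \<open>exp(-2Lt) pos_sq(\<rho>)\<close>, where
  \<open>\<rho> = (r - t)^2 - |x - x0|^2\<close> is positive exactly inside the backward cone. The energy flux through
  the level sets \<open>\<rho> = const \<ge> 0\<close> has a sign since \<open>|x - x0| \<le> r - t\<close> there, and the exponential
  absorbs the source term \<open>u_t F(u_t)\<close>, which is at most \<open>L |u_t|^2\<close> because \<open>u_t\<close> is bounded in the cone.
  So the weighted energy does not increase, and it vanishes initially.
\<close>

lemma ut_eq_0_at_cone_apex:
  assumes F: "\<And>M. \<exists>L. \<forall>v. \<bar>v\<bar> \<le> M \<longrightarrow> \<bar>F v\<bar> \<le> L * \<bar>v\<bar>"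
    and u0: "\<And>x. norm (x - x0) < r \<Longrightarrow> u 0 x = 0"
    and ut0: "\<And>x. norm (x - x0) < r \<Longrightarrow> ut 0 x = 0"
    and br: "b < r"
  shows "ut b x0 = 0"
proof -
  have "bounded ((\<lambda>z. ut (fst z) (snd z)) ` ({0..b} \<times> cball x0 r))"
    by (intro compact_imp_bounded compact_continuous_image compact_Times continuous_on_subset[OF cont_ut]) auto
  then obtain M where "\<forall>z \<in> {0..b} \<times> cball x0 r. \<bar>ut (fst z) (snd z)\<bar> \<le> M"
    unfolding bounded_iff by (auto simp only: ball_simps real_norm_def)
  then have M: "\<bar>ut t x\<bar> \<le> M" if "t \<in> {0..b}" "norm (x - x0) \<le> r" for t x
    using that by (auto simp: dist_norm norm_minus_commute)
  obtain L0 where L0: "\<And>v. \<bar>v\<bar> \<le> M \<Longrightarrow> \<bar>F v\<bar> \<le> L0 * \<bar>v\<bar>" using F by blast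
  define L where "L = \<bar>L0\<bar>"
  have L: "\<bar>F v\<bar> \<le> L * \<bar>v\<bar>" if "\<bar>v\<bar> \<le> M" for v
    using L0[OF that] mult_right_mono[of L0 L "\<bar>v\<bar>"] abs_ge_self[of L0] by (simp add: L_def)
  define \<rho> where "\<rho> t x = (r - t)\<^sup>2 - (norm (x - x0))\<^sup>2" for t x
  define e where "e t x = ((ut t x)\<^sup>2 + (\<Sum>i\<in>UNIV. (ux i t x)\<^sup>2)) / 2" for t x
  define w where "w t = exp (- (2 * L * t))" for t :: real
  define P where "P t x = w t * (pos_sq (\<rho> t x) * e t x)" for t x
  define P' where "P' t x = w t * (- 2 * L * pos_sq (\<rho> t x) * e t x
      - 2 * (r - t) * (2 * max 0 (\<rho> t x)) * e t x
      + pos_sq (\<rho> t x) * (ut t x * utt t x + (\<Sum>i\<in>UNIV. ux i t x * uxt i t x)))" for t x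
  define Q where "Q i t x = - w t * (pos_sq (\<rho> t x) * (ut t x * ux i t x))" for i t x
  define Q' where "Q' i t x = - w t * (- 2 * (x - x0) $ i * (2 * max 0 (\<rho> t x)) * (ut t x * ux i t x)
      + pos_sq (\<rho> t x) * (uxt i t x * ux i t x + ut t x * uxx i t x))" for i t x
  define N where "N = norm x0 + r + 1"

  have cont_pairs: "continuous_on ({0..b} \<times> UNIV) (\<lambda>z. \<rho> (fst z) (snd z))"
    "continuous_on ({0..b} \<times> UNIV) (\<lambda>z. e (fst z) (snd z))"
    "continuous_on ({0..b} \<times> UNIV) (\<lambda>z::real \<times> (real^'n). w (fst z))"
    unfolding \<rho>_def e_def w_def by (intro continuous_intros cont_ut cont_ux; simp)+
  have cP: "continuous_on ({0..b} \<times> UNIV) (\<lambda>z. P (fst z) (snd z))"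
    unfolding P_def by (intro continuous_intros cont_pairs)
  have cP': "continuous_on ({0..b} \<times> UNIV) (\<lambda>z. P' (fst z) (snd z))"
    unfolding P'_def by (intro continuous_intros cont_pairs cont_ut cont_utt cont_ux cont_uxt)
  have c\<rho>: "continuous_on UNIV (\<rho> t)" for t unfolding \<rho>_def by (intro continuous_intros)
  have cQ: "continuous_on UNIV (Q i t)" if "t \<in> {0..b}" for i t
    unfolding Q_def by (intro continuous_intros c\<rho> cont_slice that)
  have cQ': "continuous_on UNIV (Q' i t)" if "t \<in> {0..b}" for i t
    unfolding Q'_def by (intro continuous_intros c\<rho> cont_slice that)

  have dP: "((\<lambda>s. P s x) has_real_derivative P' t x) (at t within {0..b})" if "t \<in> {0..b}" for t x
  proof -
    have "((\<lambda>s. e s x) has_real_derivative ut t x * utt t x + (\<Sum>i\<in>UNIV. ux i t x * uxt i t x)) (at t within {0..b})"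
      unfolding e_def using that
      by (auto intro!: derivative_eq_intros ut_t ux_t simp: sum_distrib_left algebra_simps simp flip: sum_divide_distrib)
    moreover have "((\<lambda>s. \<rho> s x) has_real_derivative - 2 * (r - t)) (at t within {0..b})"
      unfolding \<rho>_def by (auto intro!: derivative_eq_intros)
    moreover have "(w has_real_derivative - 2 * L * w t) (at t within {0..b})"
      unfolding w_def by (auto intro!: derivative_eq_intros)
    ultimately show ?thesis
      unfolding P_def P'_def by (auto intro!: derivative_eq_intros simp: algebra_simps)
  qed
  have dQ: "((\<lambda>h. Q i t (x + h *\<^sub>R axis i 1)) has_real_derivative Q' i t x) (at 0)" if "t \<in> {0..b}" for i t x
  proof -
    have "\<rho> t (x + h *\<^sub>R axis i 1) = (r - t)\<^sup>2 - ((norm (x - x0))\<^sup>2 + 2 * h * (x - x0) $ i + h\<^sup>2)" for h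
      using norm_add_axis_sq[of "x - x0" h i] by (simp add: \<rho>_def algebra_simps)
    then have "((\<lambda>h. \<rho> t (x + h *\<^sub>R axis i 1)) has_real_derivative - 2 * (x - x0) $ i) (at 0)"
      by (auto intro!: derivative_eq_intros)
    then show ?thesis
      unfolding Q_def Q'_def using that
      by (auto intro!: derivative_eq_intros ut_x ux_x simp: algebra_simps)
  qed
  have outside: "pos_sq (\<rho> t x) = 0" if "t \<in> {0..b}" "norm (x - x0) \<ge> r - t" for t x
  proof -
    have "(r - t)\<^sup>2 \<le> (norm (x - x0))\<^sup>2" using that br by (intro power_mono) auto
    then show ?thesis by (simp add: \<rho>_def pos_sq_def)
  qed
  have far: "pos_sq (\<rho> t x) = 0" if "t \<in> {0..b}" "norm x \<ge> norm x0 + r" for t x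
    using that norm_triangle_ineq4[of "x - x0" "- x0"] by (intro outside) auto
  have deriv: "((\<lambda>s. integral (cube N) (P s)) has_real_derivative
      integral (cube N) (\<lambda>x. P' t x + (\<Sum>i\<in>UNIV. Q' i t x))) (at t within {0..b})" if "t \<in> {0..b}" for t
    by (rule flux_derivative[where Q = Q and M = "norm x0 + r"])
       (use that dP cP cP' dQ cQ cQ' far in \<open>auto simp: Q_def N_def\<close>)
  \<comment> \<open>The source term is absorbed by the exponential (estimate A) and the flux by the shrinking
    of the cone (estimate B).\<close>
  have dissip: "P' t x + (\<Sum>i\<in>UNIV. Q' i t x) \<le> 0" if t: "0 < t" "t \<le> b" for t x
  proof -
    define G where "G = (\<chi> i. ux i t x)"
    have G2: "(\<Sum>i\<in>UNIV. (ux i t x)\<^sup>2) = (norm G)\<^sup>2"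
      unfolding power2_norm_eq_inner by (simp add: G_def inner_vec_def power2_eq_square)
    have yG: "(\<Sum>i\<in>UNIV. (x - x0) $ i * ux i t x) = (x - x0) \<bullet> G"
      by (simp add: G_def inner_vec_def)
    have "(\<Sum>i\<in>UNIV. Q' i t x) = - w t * (- 4 * max 0 (\<rho> t x) * ut t x * (\<Sum>i\<in>UNIV. (x - x0) $ i * ux i t x)
       + pos_sq (\<rho> t x) * ((\<Sum>i\<in>UNIV. ux i t x * uxt i t x) + ut t x * (\<Sum>i\<in>UNIV. uxx i t x)))"
      unfolding Q'_def by (simp add: sum_distrib_left sum.distrib sum_negf sum_subtractf algebra_simps)
    then have "P' t x + (\<Sum>i\<in>UNIV. Q' i t x) = w t * (pos_sq (\<rho> t x) * (ut t x * F (ut t x) - 2 * L * e t x)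
        + 4 * max 0 (\<rho> t x) * (ut t x * ((x - x0) \<bullet> G) - (r - t) * e t x))"
      unfolding P'_def yG wave_eq[OF t, symmetric] by (simp add: algebra_simps)
    also have "\<dots> \<le> 0"
    proof (cases "norm (x - x0) < r - t")
      case True
      have "\<bar>ut t x * F (ut t x)\<bar> \<le> \<bar>ut t x\<bar> * (L * \<bar>ut t x\<bar>)"
        unfolding abs_mult using True t by (intro mult_left_mono L M) auto
      also have "\<dots> = L * (ut t x)\<^sup>2" by (simp add: power2_eq_square)
      also have "\<dots> \<le> L * (2 * e t x)"
        unfolding e_def G2 by (intro mult_left_mono) (auto simp: L_def)
      finally have A: "ut t x * F (ut t x) - 2 * L * e t x \<le> 0" by simp
      have "\<bar>(x - x0) \<bullet> G\<bar> \<le> (r - t) * norm G"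
        using Cauchy_Schwarz_ineq2[of "x - x0" G] True mult_right_mono[of "norm (x - x0)" "r - t" "norm G"] by auto
      then have "\<bar>ut t x * ((x - x0) \<bullet> G)\<bar> \<le> \<bar>ut t x\<bar> * ((r - t) * norm G)"
        unfolding abs_mult by (intro mult_left_mono) auto
      also have "\<dots> = (r - t) * (\<bar>ut t x\<bar> * norm G)" by simp
      also have "\<dots> \<le> (r - t) * e t x"
        unfolding e_def G2 using sum_squares_bound[of "\<bar>ut t x\<bar>" "norm G"] t br
        by (intro mult_left_mono) auto
      finally have B: "ut t x * ((x - x0) \<bullet> G) - (r - t) * e t x \<le> 0" by simp
      show ?thesis
        using A B by (intro mult_nonneg_nonpos add_nonpos_nonpos) (auto simp: w_def)
    next
      case False
      then have "pos_sq (\<rho> t x) = 0" using t by (intro outside) auto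
      then show ?thesis by (simp add: pos_sq_def)
    qed
    finally show ?thesis .
  qed
  have "integral (cube N) (P b) \<le> integral (cube N) (P 0)"
  proof (rule nonincreasing_if_deriv_nonpos[OF _ deriv])
    fix t assume t: "0 < t" "t \<le> b"
    have "continuous_on (cube N) (\<lambda>x. P' t x + (\<Sum>i\<in>UNIV. Q' i t x))"
      using t unfolding P'_def Q'_def e_def
      by (intro continuous_intros continuous_on_subset[OF c\<rho>] cont_slice) auto
    then have "(\<lambda>x. P' t x + (\<Sum>i\<in>UNIV. Q' i t x)) integrable_on cube N"
      by (rule integrable_continuous)
    then show "integral (cube N) (\<lambda>x. P' t x + (\<Sum>i\<in>UNIV. Q' i t x)) \<le> 0"
      using integral_le[of _ "cube N" "\<lambda>_. 0"] dissip[OF t] by (auto simp: integrable_0)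
  qed (use b_pos in auto)
  also have "P 0 = (\<lambda>x. 0)"
  proof
    fix x
    show "P 0 x = 0"
    proof (cases "norm (x - x0) < r")
      case True
      then have "ux i 0 x = 0" for i
        by (intro ux_eq_0_on_open[of "ball x0 r"])
           (use u0 b_pos in \<open>auto simp: dist_norm norm_minus_commute\<close>)
      then show ?thesis using True by (simp add: P_def e_def ut0)
    next
      case False
      then show ?thesis using outside[of 0 x] b_pos by (simp add: P_def)
    qed
  qed
  finally have le0: "integral (cube N) (P b) \<le> 0" by simp
  have Pnn: "0 \<le> P t x" for t x
    unfolding P_def e_def w_def by (auto intro!: mult_nonneg_nonneg add_nonneg_nonneg sum_nonneg)
  have cPb: "continuous_on (cube N) (P b)"
    unfolding P_def e_def using b_pos
    by (intro continuous_intros continuous_on_subset[OF c\<rho>] cont_slice) auto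
  have "integral (cube N) (P b) = 0"
    using le0 integral_nonneg[OF integrable_continuous[OF cPb]] Pnn by force
  then have int0: "(P b has_integral 0) (cube N)"
    using integrable_integral[OF integrable_continuous[OF cPb]] by simp
  have N1: "norm x0 < N" using br b_pos by (simp add: N_def)
  then have x0: "x0 \<in> cube N" using norm_gt_if_notin_cube[of x0 N] by fastforce
  have "box (\<chi> i. - N) (\<chi> i. N) \<noteq> ({} :: (real^'n) set)"
    using N1 norm_ge_zero[of x0] by (auto simp: interval_ne_empty_cart simp del: norm_ge_zero)
  from has_integral_0_cbox_imp_0[OF cPb _ int0 this x0] Pnn have "P b x0 = 0" by blast
  moreover have "pos_sq (\<rho> b x0) > 0" "w b > 0"
    using br by (auto simp: \<rho>_def pos_sq_def w_def)
  ultimately have "e b x0 = 0" by (simp add: P_def)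
  moreover have "0 \<le> (\<Sum>i\<in>UNIV. (ux i b x0)\<^sup>2)" by (simp add: sum_nonneg)
  ultimately show ?thesis
    by (simp add: e_def add_nonneg_eq_0_iff)
qed

lemma wave_solution_restrict:
  assumes "0 < c" "c \<le> b"
  shows "wave_solution c F u ut utt ux uxt uxx"
proof
  have sub: "{0..c} \<subseteq> {0..b}" "{0..c} \<times> UNIV \<subseteq> {0..b} \<times> (UNIV :: (real^'n) set)"
    using assms by auto
  note c = continuous_on_subset[OF _ sub(2)]
  show "continuous_on ({0..c} \<times> UNIV) (\<lambda>z. u (fst z) (snd z))"
    "continuous_on ({0..c} \<times> UNIV) (\<lambda>z. ut (fst z) (snd z))"
    "continuous_on ({0..c} \<times> UNIV) (\<lambda>z. utt (fst z) (snd z))"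
    "\<And>i. continuous_on ({0..c} \<times> UNIV) (\<lambda>z. ux i (fst z) (snd z))"
    "\<And>i. continuous_on ({0..c} \<times> UNIV) (\<lambda>z. uxt i (fst z) (snd z))"
    "\<And>i. continuous_on ({0..c} \<times> UNIV) (\<lambda>z. uxx i (fst z) (snd z))"
    by (rule c cont_u cont_ut cont_utt cont_ux cont_uxt cont_uxx)+
qed (use assms in \<open>auto intro: has_field_derivative_subset[OF u_t] has_field_derivative_subset[OF ut_t]
   has_field_derivative_subset[OF ux_t] u_x ut_x ux_x wave_eq\<close>)

text \<open>
  A point with \<open>|x| > R + t\<close> is the apex of a backward cone whose base, a ball of radius
  \<open>|x| - R > t\<close>, misses the support of the data. The boundary case follows by continuity.
\<close>

theorem finite_speed:
  assumes F: "\<And>M. \<exists>L. \<forall>v. \<bar>v\<bar> \<le> M \<longrightarrow> \<bar>F v\<bar> \<le> L * \<bar>v\<bar>"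
    and data: "\<And>x. norm x \<ge> R \<Longrightarrow> u 0 x = 0" "\<And>x. norm x \<ge> R \<Longrightarrow> ut 0 x = 0"
    and R: "R > 0" and t: "t \<in> {0..b}" and x: "norm x \<ge> R + t"
  shows "u t x = 0" "ut t x = 0" "ux i t x = 0"
proof -
  have ut: "ut s y = 0" if s: "s \<in> {0..b}" and y: "norm y > R + s" for s y
  proof (cases "s = 0")
    case True then show ?thesis using data(2) y by simp
  next
    case False
    then interpret cut: wave_solution s F u ut utt ux uxt uxx
      using s by (intro wave_solution_restrict) auto
    have near: "norm z \<ge> R" if "norm (z - y) < norm y - R" for z
      using that norm_triangle_ineq2[of y "y - z"] by (simp add: norm_minus_commute)
    show ?thesis
      by (rule cut.ut_eq_0_at_cone_apex[OF F, where r = "norm y - R"])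
         (use data near y in auto)
  qed
  have u: "u s y = 0" if s: "s \<in> {0..b}" and y: "norm y > R + s" for s y
  proof -
    have "u s y = u 0 y"
    proof (rule has_field_derivative_zero_constant[of "{0..s}" "\<lambda>s. u s y", THEN exE])
      show "((\<lambda>s. u s y) has_real_derivative 0) (at \<sigma> within {0..s})" if "\<sigma> \<in> {0..s}" for \<sigma>
        using has_field_derivative_subset[OF u_t, of \<sigma> "{0..s}" y] ut[of \<sigma> y] that s y by auto
    qed (use s in auto)
    then show ?thesis using data(1) s y by simp
  qed
  have ext: "f x = 0" if "continuous_on UNIV f" "\<And>y. norm y > R + t \<Longrightarrow> f y = 0" for f :: "real^'n \<Rightarrow> real"
  proof (cases "norm x > R + t")
    case False
    with x have "norm x = R + t" by simp
    then have pos: "norm x > 0" using R t by simp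
    have "f (x + inverse (real (Suc n)) *\<^sub>R x) = 0" for n
    proof (rule that(2))
      have "x + inverse (real (Suc n)) *\<^sub>R x = (1 + inverse (real (Suc n))) *\<^sub>R x"
        by (simp add: scaleR_add_left)
      then have "norm (x + inverse (real (Suc n)) *\<^sub>R x) = (1 + inverse (real (Suc n))) * norm x"
        by simp
      also have "\<dots> > 1 * norm x" using pos by (intro mult_strict_right_mono) auto
      finally show "norm (x + inverse (real (Suc n)) *\<^sub>R x) > R + t" using x by simp
    qed
    moreover have "(\<lambda>n. f (x + inverse (real (Suc n)) *\<^sub>R x)) \<longlonglongrightarrow> f (x + 0 *\<^sub>R x)"
      by (intro continuous_on_tendsto_compose[OF that(1)] tendsto_intros LIMSEQ_inverse_real_of_nat) auto
    ultimately show ?thesis by (simp add: LIMSEQ_const_iff)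
  qed (use that in auto)
  have ux: "ux i t y = 0" if "norm y > R + t" for y
    by (rule ux_eq_0_on_open[of "{y. norm y > R + t}"])
       (use that t u in \<open>auto intro!: open_Collect_less continuous_intros\<close>)
  show "u t x = 0" by (rule ext) (use u t cont_slice in auto)
  show "ut t x = 0" by (rule ext) (use ut t cont_slice in auto)
  show "ux i t x = 0" by (rule ext) (use ux t cont_slice in auto)
qed
end

section \<open>Averages over outgoing characteristics\<close>

text \<open>
  The second difference of \<open>pos_sq\<close> is a \<open>C^1\<close> transition from 0 to 1 given by a single formula; it
  is quadratic on \<open>[0,1]\<close> and on \<open>[1,2]\<close>.
\<close>

definition ramp :: "real \<Rightarrow> real" where
  "ramp s = (pos_sq s - 2 * pos_sq (s - 1) + pos_sq (s - 2)) / 2"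

definition ramp' :: "real \<Rightarrow> real" where
  "ramp' s = max 0 s - 2 * max 0 (s - 1) + max 0 (s - 2)"

lemma has_real_derivative_ramp: "(ramp has_real_derivative ramp' s) (at s within A)"
  unfolding ramp_def ramp'_def by (auto intro!: derivative_eq_intros)

lemma ramp_eq_0: "s \<le> 0 \<Longrightarrow> ramp s = 0"
  by (simp add: ramp_def pos_sq_def)

lemma ramp_eq_1: "2 \<le> s \<Longrightarrow> ramp s = 1"
  by (simp add: ramp_def pos_sq_def max_def) (simp add: power2_eq_square algebra_simps)

lemma ramp_bounds: "0 \<le> ramp s" "ramp s \<le> 1"
proof -
  consider "s \<le> 0" | "0 < s" "s \<le> 1" | "1 < s" "s \<le> 2" | "2 < s" by linarith
  then have "0 \<le> ramp s \<and> ramp s \<le> 1"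
  proof cases
    case 2
    then have "ramp s = s\<^sup>2 / 2" by (simp add: ramp_def pos_sq_def)
    moreover have "s\<^sup>2 \<le> 1\<^sup>2" using 2 by (intro power_mono) auto
    ultimately show ?thesis using zero_le_power2[of s] unfolding one_power2 by linarith
  next
    case 3
    then have "ramp s = 1 - (2 - s)\<^sup>2 / 2"
      by (simp add: ramp_def pos_sq_def) (simp add: power2_eq_square algebra_simps)
    moreover have "(2 - s)\<^sup>2 \<le> 1\<^sup>2" using 3 by (intro power_mono) auto
    ultimately show ?thesis by simp
  qed (simp_all add: ramp_eq_0 ramp_eq_1)
  then show "0 \<le> ramp s" "ramp s \<le> 1" by auto
qed

lemma continuous_on_ramp [continuous_intros]:
  "continuous_on A f \<Longrightarrow> continuous_on A (\<lambda>x. ramp (f x))"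
  "continuous_on A f \<Longrightarrow> continuous_on A (\<lambda>x. ramp' (f x))"
  unfolding ramp_def ramp'_def by (intro continuous_intros; simp)+

lemma convex_tangent_line:
  fixes F :: "real \<Rightarrow> real"
  assumes "convex_on UNIV F"
  shows "\<exists>k. \<forall>v. F w + k * (v - w) \<le> F v"
  using convex_le_Inf_differential[OF assms, of w] by auto

text \<open>
  For \<open>t \<ge> 3R\<close> a box containing the points with \<open>|x| \<le> R + t\<close> and \<open>x$k \<ge> t - 3R\<close>: there the other
  coordinates are bounded by the square root of \<open>(R + t)^2 - (t - 3R)^2 \<le> 8Rt\<close>.
\<close>

definition slab :: "'n \<Rightarrow> real \<Rightarrow> real \<Rightarrow> (real^'n) set" where
  "slab k R t = cbox (\<chi> i. if i = k then t - 3 * R else - sqrt (8 * R * t))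
                     (\<chi> i. if i = k then t + R else sqrt (8 * R * t))"

lemma measure_slab:
  fixes k :: "'n::finite"
  assumes "0 \<le> R" "0 \<le> t"
  shows "measure lebesgue (slab k R t) = 4 * R * (2 * sqrt (8 * R * t)) ^ (CARD('n) - 1)"
proof -
  have ne: "slab k R t \<noteq> {}"
    using assms by (auto simp: slab_def interval_ne_empty_cart)
  have "measure lebesgue (slab k R t) = measure lborel (slab k R t)"
    by (simp add: slab_def)
  also have "\<dots> = (\<Prod>i\<in>UNIV. (\<chi> i. if i = k then t + R else sqrt (8 * R * t)) $ i
      - (\<chi> i. if i = k then t - 3 * R else - sqrt (8 * R * t)) $ i)"
    using ne unfolding slab_def by (rule content_cbox_cart)
  also have "\<dots> = (\<Prod>i\<in>UNIV. if i = k then 4 * R else 2 * sqrt (8 * R * t))"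
    by (rule prod.cong) auto
  also have "\<dots> = 4 * R * (2 * sqrt (8 * R * t)) ^ (CARD('n) - 1)"
    by (subst prod.remove[of _ k]) (auto simp: card_Diff_singleton)
  finally show ?thesis .
qed

lemma mem_slab:
  assumes "3 * R \<le> t" "0 < R" "norm (x::real^'n) \<le> R + t" "t - 3 * R \<le> x $ k"
  shows "x \<in> slab k R t"
proof -
  have xk: "x $ k \<le> t + R" using component_le_norm_cart[of x k] assms by auto
  have "\<bar>x $ i\<bar> \<le> sqrt (8 * R * t)" if "i \<noteq> k" for i
  proof (rule real_le_rsqrt)
    have "(\<Sum>j\<in>{i, k}. (x $ j)\<^sup>2) \<le> (\<Sum>j\<in>UNIV. (x $ j)\<^sup>2)"
      by (rule sum_mono2) auto
    also have "\<dots> = (norm x)\<^sup>2"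
      unfolding power2_norm_eq_inner by (simp add: inner_vec_def power2_eq_square)
    also have "\<dots> \<le> (R + t)\<^sup>2" using assms by (intro power_mono) auto
    finally have "(x $ i)\<^sup>2 + (x $ k)\<^sup>2 \<le> (R + t)\<^sup>2" using that by simp
    moreover have "(t - 3 * R)\<^sup>2 \<le> (x $ k)\<^sup>2" using assms by (intro power_mono) auto
    moreover have "(R + t)\<^sup>2 - (t - 3 * R)\<^sup>2 = 8 * R * t - 8 * R\<^sup>2"
      by (simp add: power2_eq_square algebra_simps)
    moreover have "0 \<le> R\<^sup>2" by simp
    ultimately show "\<bar>x $ i\<bar>\<^sup>2 \<le> 8 * R * t" unfolding power2_abs by linarith
  qed
  then show ?thesis using xk assms by (auto simp: slab_def mem_box_cart abs_le_iff minus_le_iff)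
qed

context wave_solution
begin

text \<open>
  For \<open>\<sigma> = 1\<close> the weight moves outwards and for \<open>\<sigma> = -1\<close> inwards. Write
  \<open>u_tt - \<Delta>u = (\<partial>_t + \<sigma> \<partial>_k)(u_t - \<sigma> u_k) - (sum of u_ii over i \<noteq> k)\<close>, which uses \<open>\<sigma>^2 = 1\<close>. The
  operator \<open>\<partial>_t + \<sigma> \<partial>_k\<close> annihilates the weight, and the remaining terms are derivatives in
  directions in which the weight is constant.
\<close>

lemma traveling_average_deriv:
  fixes \<psi> \<psi>' :: "real \<Rightarrow> real" and k :: 'n
  assumes supp: "\<And>t x. t \<in> {0..b} \<Longrightarrow> norm x \<ge> R + t \<Longrightarrow> ut t x = 0"
    "\<And>i t x. t \<in> {0..b} \<Longrightarrow> norm x \<ge> R + t \<Longrightarrow> ux i t x = 0"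
    and d\<psi>: "\<And>z. (\<psi> has_real_derivative \<psi>' z) (at z)"
    and c\<psi>': "continuous_on UNIV \<psi>'"
    and N: "R + b < N" and \<sigma>: "\<sigma> * \<sigma> = 1" and t: "t \<in> {0..b}"
  shows "((\<lambda>s. integral (cube N) (\<lambda>x. (ut s x - \<sigma> * ux k s x) * \<psi> (x $ k - \<sigma> * s + c))) has_real_derivative
     integral (cube N) (\<lambda>x. (utt t x - (\<Sum>i\<in>UNIV. uxx i t x)) * \<psi> (x $ k - \<sigma> * t + c))) (at t within {0..b})"
proof -
  define z where "z t x = x $ k - \<sigma> * t + c" for t and x :: "real^'n"
  define P where "P t x = (ut t x - \<sigma> * ux k t x) * \<psi> (z t x)" for t x
  define P' where "P' t x = (utt t x - \<sigma> * uxt k t x) * \<psi> (z t x)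
     - \<sigma> * (ut t x - \<sigma> * ux k t x) * \<psi>' (z t x)" for t x
  define \<delta> where "\<delta> i = (if i = k then 1 else 0 :: real)" for i
  define Q where "Q i t x = (\<delta> i * \<sigma> * ut t x - ux i t x) * \<psi> (z t x)" for i t x
  define Q' where "Q' i t x = (\<delta> i * \<sigma> * uxt i t x - uxx i t x) * \<psi> (z t x)
     + (\<delta> i * \<sigma> * ut t x - ux i t x) * (\<delta> i * \<psi>' (z t x))" for i t x
  have c\<psi>: "continuous_on UNIV \<psi>" using d\<psi> by (intro DERIV_continuous_on)
  have comp: "continuous_on A (\<lambda>p. \<phi> (f p))" if "continuous_on A f" "continuous_on UNIV \<phi>"
    for A :: "'z::topological_space set" and f and \<phi> :: "real \<Rightarrow> real"
    by (rule continuous_on_compose2[OF that(2,1)]) auto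
  have cz: "continuous_on A (\<lambda>p. z (fst p) (snd p))" "continuous_on B (z t)" for A t B
    unfolding z_def by (intro continuous_intros)+
  have "((\<lambda>s. integral (cube N) (P s)) has_real_derivative
      integral (cube N) (\<lambda>x. P' t x + (\<Sum>i\<in>UNIV. Q' i t x))) (at t within {0..b})"
  proof (rule flux_derivative[where Q = Q and M = "R + b"])
    show "((\<lambda>s. P s x) has_real_derivative P' t x) (at t within {0..b})" if "t \<in> {0..b}" for t x
      unfolding P_def P'_def z_def using that
      by (auto intro!: derivative_eq_intros ut_t ux_t DERIV_chain2[OF d\<psi>] simp: algebra_simps)
    show "continuous_on ({0..b} \<times> UNIV) (\<lambda>z. P (fst z) (snd z))"
      "continuous_on ({0..b} \<times> UNIV) (\<lambda>z. P' (fst z) (snd z))"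
      unfolding P_def P'_def
      by (intro continuous_intros cont_ut cont_ux cont_utt cont_uxt comp[OF _ c\<psi>] comp[OF _ c\<psi>'] cz)+
    show "continuous_on UNIV (Q i t)" "continuous_on UNIV (Q' i t)" for i
      unfolding Q_def Q'_def using t
      by (intro continuous_intros cont_slice comp[OF _ c\<psi>] comp[OF _ c\<psi>'] cz; simp)+
    show "((\<lambda>h. Q i t (x + h *\<^sub>R axis i 1)) has_real_derivative Q' i t x) (at 0)" for i x
    proof -
      have "((\<lambda>h. z t (x + h *\<^sub>R axis i 1)) has_real_derivative \<delta> i) (at 0)"
        unfolding z_def \<delta>_def by (auto intro!: derivative_eq_intros simp: axis_def)
      from DERIV_chain2[OF d\<psi> this]
      have "((\<lambda>h. \<psi> (z t (x + h *\<^sub>R axis i 1))) has_real_derivative \<psi>' (z t x) * \<delta> i) (at 0)" by simp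
      then show ?thesis
        unfolding Q_def Q'_def using t
        by (auto intro!: derivative_eq_intros ut_x ux_x simp: algebra_simps)
    qed
    show "Q i t x = 0" if "norm x \<ge> R + b" for i x
      using that t supp by (simp add: Q_def)
  qed (use N t in auto)
  moreover have "P' t x + (\<Sum>i\<in>UNIV. Q' i t x) = (utt t x - (\<Sum>i\<in>UNIV. uxx i t x)) * \<psi> (z t x)" for x
  proof -
    have "(\<Sum>i\<in>UNIV. Q' i t x) = (\<Sum>i\<in>UNIV. \<delta> i * (\<sigma> * uxt i t x * \<psi> (z t x) + (\<delta> i * \<sigma> * ut t x - ux i t x) * \<psi>' (z t x)))
        - (\<Sum>i\<in>UNIV. uxx i t x) * \<psi> (z t x)"
      unfolding Q'_def by (simp add: sum_distrib_left sum_distrib_right sum.distrib sum_subtractf algebra_simps)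
    also have "(\<Sum>i\<in>UNIV. \<delta> i * (\<sigma> * uxt i t x * \<psi> (z t x) + (\<delta> i * \<sigma> * ut t x - ux i t x) * \<psi>' (z t x)))
       = \<sigma> * uxt k t x * \<psi> (z t x) + (\<sigma> * ut t x - ux k t x) * \<psi>' (z t x)"
      unfolding \<delta>_def by (subst sum.remove[of _ k]) auto
    also have "(\<sigma> * ut t x - ux k t x) = \<sigma> * (ut t x - \<sigma> * ux k t x)"
      using \<sigma> by (simp add: algebra_simps flip: mult.assoc)
    finally show ?thesis by (simp add: P'_def algebra_simps)
  qed
  ultimately show ?thesis by (simp add: P_def[abs_def] z_def)
qed

text \<open>
  \<open>Y\<close> is the average of \<open>u_t - u_k\<close> with the weight \<open>\<psi>(x$k - t)\<close>. The growth estimate is Jensen's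
  inequality in the form of a tangent line of \<open>F\<close> at \<open>v0 = Y/(2m)\<close>. Since the tangent line is
  nonpositive at 0, \<open>m\<close> need not be the exact mass of the weight: any upper bound for the volume of a
  set outside which the integrand vanishes will do, and the slab is such a set.
\<close>

theorem outgoing_average_growth:
  fixes R :: real
  assumes R: "R > 0"
    and F: "\<And>M. \<exists>L. \<forall>v. \<bar>v\<bar> \<le> M \<longrightarrow> \<bar>F v\<bar> \<le> L * \<bar>v\<bar>"
    and F_nonneg: "\<And>v. 0 \<le> F v" and F_convex: "convex_on UNIV F"
    and data: "\<And>x. norm x \<ge> R \<Longrightarrow> u 0 x = 0" "\<And>x. norm x \<ge> R \<Longrightarrow> ut 0 x = 0"
  obtains Y Y' where "Y 0 = integral UNIV (ut 0)"
    and "\<And>t. t \<in> {0..b} \<Longrightarrow> (Y has_real_derivative Y' t) (at t within {0..b})"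
    and "\<And>t. 0 < t \<Longrightarrow> t \<le> b \<Longrightarrow> 0 \<le> Y' t"
    and "\<And>t m. 3 * R \<le> t \<Longrightarrow> t \<le> b \<Longrightarrow> 0 < Y t \<Longrightarrow>
       4 * R * (2 * sqrt (8 * R * t)) ^ (CARD('n) - 1) \<le> m \<Longrightarrow> m * F (Y t / (2 * m)) \<le> Y' t"
proof -
  have supp: "u t x = 0" "ut t x = 0" "ux i t x = 0" if "t \<in> {0..b}" "norm x \<ge> R + t" for i t x
    by (rule finite_speed[OF F data R that], assumption+)+
  obtain k :: 'n where True by blast
  define N where "N = R + b + 1"
  have N: "R + b < N" by (simp add: N_def)
  have out: "norm x \<ge> R + t" if "x \<notin> cube N" "t \<in> {0..b}" for x :: "real^'n" and t
    using norm_gt_if_notin_cube[OF that(1)] that(2) N by auto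
  \<comment> \<open>The ramp has width 2, so the transition from 0 to 1 takes place on \<open>[-3R,-R]\<close>.\<close>
  define \<psi> where "\<psi> z = ramp ((z + 3 * R) / R)" for z
  define \<psi>' where "\<psi>' z = ramp' ((z + 3 * R) / R) / R" for z
  have d\<psi>: "(\<psi> has_real_derivative \<psi>' z) (at z)" for z
  proof -
    have "((\<lambda>z. (z + 3 * R) / R) has_real_derivative 1 / R) (at z)"
      using R by (auto intro!: derivative_eq_intros)
    from DERIV_chain2[OF has_real_derivative_ramp this] show ?thesis
      unfolding \<psi>_def[abs_def] \<psi>'_def by simp
  qed
  have c\<psi>': "continuous_on UNIV \<psi>'" and c\<psi>: "continuous_on UNIV \<psi>"
    unfolding \<psi>'_def \<psi>_def using R by (intro continuous_intros; simp)+
  have \<psi>0: "\<psi> z = 0" if "z \<le> - 3 * R" for z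
    unfolding \<psi>_def using that R by (intro ramp_eq_0) (simp add: field_simps)
  have \<psi>1: "\<psi> z = 1" if "z \<ge> - R" for z
    unfolding \<psi>_def using that R by (intro ramp_eq_1) (simp add: field_simps)
  have \<psi>_bounds: "0 \<le> \<psi> z" "\<psi> z \<le> 1" for z unfolding \<psi>_def using ramp_bounds by auto
  have c\<psi>x: "continuous_on A (\<lambda>x. \<psi> (x $ k - s + c))" for s c and A :: "(real^'n) set"
    by (rule continuous_on_compose2[OF c\<psi>]) (auto intro!: continuous_intros)
  define src where "src t x = utt t x - (\<Sum>i\<in>UNIV. uxx i t x)" for t x
  have src: "src t x = F (ut t x)" if "0 < t" "t \<le> b" for t x
    using wave_eq[OF that] by (simp add: src_def)
  have csrc: "continuous_on A (src t)" if "t \<in> {0..b}" for A t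
    unfolding src_def by (intro continuous_intros cont_slice that)
  have int: "(\<lambda>x. f x * \<psi> (x $ k - s + c)) integrable_on cube N" if "continuous_on (cube N) f" for f s c
    by (intro integrable_continuous continuous_intros c\<psi>x that)

  define Y where "Y s = integral (cube N) (\<lambda>x. (ut s x - ux k s x) * \<psi> (x $ k - s))" for s
  define Y' where "Y' t = integral (cube N) (\<lambda>x. src t x * \<psi> (x $ k - t))" for t
  have dY: "(Y has_real_derivative Y' t) (at t within {0..b})" if "t \<in> {0..b}" for t
    using traveling_average_deriv[OF supp(2,3) d\<psi> c\<psi>' N, of 1 t k 0] that
    by (simp add: Y_def[abs_def] Y'_def src_def)
  have Y'_nonneg: "0 \<le> Y' t" if "0 < t" "t \<le> b" for t
    unfolding Y'_def using int[OF csrc, of t t 0] that src F_nonneg \<psi>_bounds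
    by (intro integral_nonneg) auto
  have Y0: "Y 0 = integral UNIV (ut 0)"
  proof -
    have b0: "0 \<in> {0..b}" using b_pos by simp
    have "(ut 0 x - ux k 0 x) * \<psi> (x $ k - 0) = ut 0 x - ux k 0 x" for x
    proof (cases "norm x \<ge> R")
      case True then show ?thesis using supp(2,3)[OF b0] by simp
    next
      case False
      then show ?thesis using component_le_norm_cart[of x k] by (subst \<psi>1) auto
    qed
    then have "Y 0 = integral (cube N) (\<lambda>x. ut 0 x - ux k 0 x)"
      unfolding Y_def by (intro integral_cong)
    also have "\<dots> = integral (cube N) (ut 0) - integral (cube N) (ux k 0)"
      by (intro integral_diff integrable_continuous cont_slice b0)
    also have "integral (cube N) (ux k 0) = 0"
      by (rule integral_partial_derivative_eq_0[of "u 0" "axis k 1" _ R])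
         (use u_x[OF b0] cont_slice[OF b0] data(1) b_pos in \<open>auto simp: N_def\<close>)
    also have "integral (cube N) (ut 0) = integral UNIV (ut 0)"
      using supp(2)[OF b0] out[OF _ b0] by (intro integral_cbox_eq_UNIV) auto
    finally show ?thesis by simp
  qed
  \<comment> \<open>The average \<open>Z\<close> of \<open>u_t + u_k\<close> with a weight that moves inwards and coincides with that of \<open>Y\<close> at
    time \<open>t\<close> is nondecreasing. At time 0 its weight \<open>\<psi>(x$k - 2t)\<close> vanishes on the support of the data
    because \<open>R - 2t \<le> -3R\<close>. Hence \<open>2 \<integral>u_t \<psi> = Y + Z \<ge> Y\<close>.\<close>
  have half: "Y t / 2 \<le> integral (cube N) (\<lambda>x. ut t x * \<psi> (x $ k - t))" if t: "2 * R \<le> t" "t \<le> b" for t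
  proof -
    define Z where "Z s = integral (cube N) (\<lambda>x. (ut s x + ux k s x) * \<psi> (x $ k + s - 2 * t))" for s
    define Z' where "Z' s = integral (cube N) (\<lambda>x. src s x * \<psi> (x $ k + s - 2 * t))" for s
    have tb: "t \<in> {0..b}" "0 \<in> {0..b}" using t R by auto
    have dZ: "(Z has_real_derivative Z' s) (at s within {0..b})" if "s \<in> {0..b}" for s
      using traveling_average_deriv[OF supp(2,3) d\<psi> c\<psi>' N, of "-1" s k "- 2 * t"] that
      by (simp add: Z_def[abs_def] Z'_def src_def)
    have "- Z t \<le> - Z 0"
    proof (rule nonincreasing_if_deriv_nonpos[where f = "\<lambda>s. - Z s"])
      show "((\<lambda>s. - Z s) has_real_derivative - Z' s) (at s within {0..t})" if "s \<in> {0..t}" for s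
        by (intro DERIV_minus has_field_derivative_subset[OF dZ]) (use that t in auto)
      show "- Z' s \<le> 0" if "0 < s" "s \<le> t" for s
        unfolding Z'_def using int[OF csrc, of s "- s" "- 2 * t"] that t src F_nonneg \<psi>_bounds
        by (auto intro!: integral_nonneg)
    qed (use tb in auto)
    moreover have "Z 0 = 0"
    proof -
      have "(ut 0 x + ux k 0 x) * \<psi> (x $ k + 0 - 2 * t) = 0" for x
      proof (cases "norm x \<ge> R")
        case True then show ?thesis using supp(2,3)[OF tb(2)] by simp
      next
        case False
        then show ?thesis using component_le_norm_cart[of x k] t R by (subst \<psi>0) auto
      qed
      then have "(\<lambda>x. (ut 0 x + ux k 0 x) * \<psi> (x $ k + 0 - 2 * t)) = (\<lambda>_. 0)"
        by (rule ext)
      then show ?thesis unfolding Z_def by (simp only: integral_0)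
    qed
    ultimately have "0 \<le> Z t" by simp
    moreover have "Y t + Z t = 2 * integral (cube N) (\<lambda>x. ut t x * \<psi> (x $ k - t))"
    proof -
      have "Y t + Z t = integral (cube N) (\<lambda>x. (ut t x - ux k t x) * \<psi> (x $ k - t) + (ut t x + ux k t x) * \<psi> (x $ k - t))"
        unfolding Y_def Z_def using tb(1)
          int[of "\<lambda>x. ut t x - ux k t x" t 0] int[of "\<lambda>x. ut t x + ux k t x" t 0]
        by (subst integral_add) (simp_all add: continuous_intros cont_slice)
      also have "\<dots> = integral (cube N) (\<lambda>x. 2 * (ut t x * \<psi> (x $ k - t)))"
        by (intro integral_cong) (simp add: algebra_simps)
      finally show ?thesis by simp
    qed
    ultimately show ?thesis by simp
  qed
  have growth: "m * F (Y t / (2 * m)) \<le> Y' t"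
    if t: "3 * R \<le> t" "t \<le> b" and Y: "0 < Y t"
      and m: "4 * R * (2 * sqrt (8 * R * t)) ^ (CARD('n) - 1) \<le> m" for t m
  proof -
    have tb: "t \<in> {0..b}" and t0: "0 < t" using t R by auto
    have "0 < 4 * R * (2 * sqrt (8 * R * t)) ^ (CARD('n) - 1)" using R t0 by simp
    then have m0: "0 < m" using m by linarith
    define v0 where "v0 = Y t / (2 * m)"
    have v0: "0 < v0" using Y m0 by (simp add: v0_def)
    obtain \<kappa> where tangent: "\<And>v. F v0 + \<kappa> * (v - v0) \<le> F v"
      using convex_tangent_line[OF F_convex, of v0] by blast
    have F0: "F 0 = 0" using F[of 0] by auto
    have A: "F v0 - \<kappa> * v0 \<le> 0" using tangent[of 0] F0 by simp
    then have "0 \<le> \<kappa>" using F_nonneg[of v0] v0 by (smt (verit) mult_neg_pos)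
    let ?S = "slab k R t" and ?w = "\<lambda>x. \<psi> (x $ k - t)"
    have meas: "?S \<inter> cube N \<in> lmeasurable" "?S \<in> lmeasurable" by (auto simp: slab_def)
    have "measure lebesgue (?S \<inter> cube N) \<le> measure lebesgue ?S"
      using meas by (intro measure_mono_fmeasurable) auto
    also have "\<dots> \<le> m" using m R t0 by (simp add: measure_slab)
    finally have vol: "integral (cube N) (indicat_real ?S) \<le> m"
      using integral_indicator[OF meas(1)] by simp
    have pointwise: "(F v0 - \<kappa> * v0) * indicat_real ?S x + \<kappa> * (ut t x * ?w x) \<le> src t x * ?w x" for x
    proof (cases "x \<in> ?S")
      case True
      have "F v0 - \<kappa> * v0 \<le> (F v0 - \<kappa> * v0) * ?w x"
        using A \<psi>_bounds(2)[of "x $ k - t"] mult_left_mono_neg[of "?w x" 1 "F v0 - \<kappa> * v0"] by simp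
      moreover have "(F v0 + \<kappa> * (ut t x - v0)) * ?w x \<le> F (ut t x) * ?w x"
        by (intro mult_right_mono tangent \<psi>_bounds)
      ultimately show ?thesis using True src[OF t0 t(2)] by (simp add: algebra_simps)
    next
      case False
      then have "norm x \<ge> R + t \<or> x $ k < t - 3 * R"
        using mem_slab[OF t(1) R, of x k] by linarith
      then have "ut t x = 0 \<or> ?w x = 0" using supp(2)[OF tb] \<psi>0 by auto
      then show ?thesis using False src[OF t0 t(2)] F0 by auto
    qed
    have i1: "indicat_real ?S integrable_on cube N"
      using meas by (simp add: integrable_on_indicator)
    have i2: "(\<lambda>x. ut t x * ?w x) integrable_on cube N"
      using int[of "ut t" t 0] cont_slice[OF tb] by simp
    have i3: "(\<lambda>x. src t x * ?w x) integrable_on cube N"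
      using int[of "src t" t 0] csrc[OF tb] by simp
    have "m * F v0 = (F v0 - \<kappa> * v0) * m + \<kappa> * (Y t / 2)"
      using m0 by (simp add: v0_def field_simps)
    also have "\<dots> \<le> (F v0 - \<kappa> * v0) * integral (cube N) (indicat_real ?S)
        + \<kappa> * integral (cube N) (\<lambda>x. ut t x * ?w x)"
      using A vol \<open>0 \<le> \<kappa>\<close> half[of t] t R
      by (intro add_mono mult_left_mono mult_left_mono_neg) auto
    also have "\<dots> = integral (cube N) (\<lambda>x. (F v0 - \<kappa> * v0) * indicat_real ?S x + \<kappa> * (ut t x * ?w x))"
      using i1 i2 by (subst integral_add) (auto intro!: integrable_on_mult_right)
    also have "\<dots> \<le> integral (cube N) (\<lambda>x. src t x * ?w x)"
      using i1 i2 i3 pointwise by (intro integral_le integrable_add integrable_on_mult_right) auto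
    finally show ?thesis by (simp add: Y'_def v0_def)
  qed
  show ?thesis using that[of Y Y'] Y0 dY Y'_nonneg growth by blast
qed

end

section \<open>The ordinary differential inequality\<close>

lemma p_Gla_eq:
  assumes "2 \<le> n"
  shows "p_Gla n = 1 + 2 / (real n - 1)"
proof -
  have "real n + 1 = (real n - 1) + 2" "real n - 1 \<noteq> 0" using assms by auto
  then show ?thesis unfolding p_Gla_def by (metis add_divide_distrib divide_self)
qed

lemma nonlinearity_nonneg:
  assumes "modulus_of_continuity \<mu>"
  shows "0 \<le> nonlinearity n \<mu> v"
  using assms by (simp add: nonlinearity_def modulus_of_continuity_def)

text \<open>
  The linear bound on bounded sets is what the energy estimate needs; it holds because the
  Glassey exponent exceeds 1.
\<close>

lemma nonlinearity_linear_bound: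
  assumes modulus: "modulus_of_continuity \<mu>" and n: "2 \<le> n"
  shows "\<exists>L. \<forall>v. \<bar>v\<bar> \<le> M \<longrightarrow> \<bar>nonlinearity n \<mu> v\<bar> \<le> L * \<bar>v\<bar>"
proof (intro exI allI impI)
  fix v assume v: "\<bar>v\<bar> \<le> M"
  note p = p_Gla_eq[OF n]
  have "\<bar>v\<bar> powr p_Gla n = \<bar>v\<bar> * \<bar>v\<bar> powr (2 / (real n - 1))"
    unfolding p powr_add by simp
  moreover have "\<bar>v\<bar> powr (2 / (real n - 1)) \<le> M powr (2 / (real n - 1))"
    using v n by (intro powr_mono2) auto
  moreover have "\<mu> \<bar>v\<bar> \<le> \<mu> M" "0 \<le> \<mu> \<bar>v\<bar>"
    using modulus v by (auto simp: modulus_of_continuity_def mono_on_def)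
  ultimately have "\<bar>v\<bar> powr p_Gla n * \<mu> \<bar>v\<bar> \<le> (\<bar>v\<bar> * M powr (2 / (real n - 1))) * \<mu> M"
    by (intro mult_mono) (simp_all add: mult_left_mono)
  then show "\<bar>nonlinearity n \<mu> v\<bar> \<le> (M powr (2 / (real n - 1)) * \<mu> M) * \<bar>v\<bar>"
    using \<open>0 \<le> \<mu> \<bar>v\<bar>\<close> by (simp add: nonlinearity_def abs_mult algebra_simps)
qed

context
  fixes \<mu> :: "real \<Rightarrow> real" and \<tau>\<^sub>0 :: real
  assumes modulus: "modulus_of_continuity \<mu>" and not_dini: "\<not> dini_condition \<mu>" and \<tau>\<^sub>0: "\<tau>\<^sub>0 > 0"
begin

text \<open>
  If \<open>\<mu>\<close> vanished at some positive point, then by monotonicity the Dini integral would vanish on an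
  initial interval.
\<close>

lemma modulus_pos: "0 < \<mu> \<tau>" if "0 < \<tau>"
proof (rule ccontr)
  assume "\<not> 0 < \<mu> \<tau>"
  have zero: "\<mu> \<sigma> = 0" if "\<sigma> \<in> {0<..\<tau>}" for \<sigma>
  proof -
    have "\<mu> \<sigma> \<le> \<mu> \<tau>" "0 \<le> \<mu> \<sigma>"
      using modulus that by (auto simp: modulus_of_continuity_def mono_on_def)
    with \<open>\<not> 0 < \<mu> \<tau>\<close> show ?thesis by simp
  qed
  have "(\<integral>\<^sup>+\<sigma>\<in>{0<..\<tau>}. ennreal (\<mu> \<sigma> / \<sigma>) \<partial>lborel) = (\<integral>\<^sup>+(\<sigma>::real). 0 \<partial>lborel)"
    by (intro nn_integral_cong) (use zero in \<open>auto split: split_indicator\<close>)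
  then have "dini_condition \<mu>"
    unfolding dini_condition_def using that by (intro exI[of _ \<tau>]) simp
  with not_dini show False by simp
qed

lemma H_integrand_continuous:
  assumes "0 < a"
  shows "continuous_on {a..c} (\<lambda>\<sigma>. \<mu> \<sigma> / \<sigma>)"
proof -
  have "continuous_on {0..} \<mu>" using modulus by (simp add: modulus_of_continuity_def)
  then have "continuous_on {a..c} \<mu>" by (rule continuous_on_subset) (use assms in auto)
  then show ?thesis by (intro continuous_intros) (use assms in auto)
qed

lemma H_has_derivative:
  assumes "0 < a" "\<tau> \<in> {a..\<tau>\<^sub>0}"
  shows "(H \<mu> \<tau>\<^sub>0 has_real_derivative - (\<mu> \<tau> / \<tau>)) (at \<tau> within {a..\<tau>\<^sub>0})"
  unfolding H_def using integral_has_real_derivative'[OF H_integrand_continuous assms(2)] assms(1) by simp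

lemma H_strict_antimono:
  assumes "0 < \<sigma>" "\<sigma> < \<tau>" "\<tau> \<le> \<tau>\<^sub>0"
  shows "H \<mu> \<tau>\<^sub>0 \<tau> < H \<mu> \<tau>\<^sub>0 \<sigma>"
proof (rule DERIV_neg_imp_decreasing_open[OF assms(2)])
  have d: "(H \<mu> \<tau>\<^sub>0 has_real_derivative - (\<mu> t / t)) (at t within {\<sigma>..\<tau>\<^sub>0})" if "t \<in> {\<sigma>..\<tau>\<^sub>0}" for t
    by (rule H_has_derivative[OF assms(1) that])
  show "continuous_on {\<sigma>..\<tau>} (H \<mu> \<tau>\<^sub>0)"
    by (rule continuous_on_subset[OF DERIV_continuous_on[OF d]]) (use assms in auto)
  fix t assume t: "\<sigma> < t" "t < \<tau>"
  have "at t within {\<sigma>..\<tau>\<^sub>0} = at t" using t assms by (intro at_within_interior) auto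
  with d[of t] t assms modulus_pos[of t]
  show "\<exists>y. (H \<mu> \<tau>\<^sub>0 has_real_derivative y) (at t) \<and> y < 0"
    by (intro exI[of _ "- (\<mu> t / t)"]) auto
qed

text \<open>
  By monotone convergence the Dini integral is the supremum of the values \<open>H(\<tau>\<^sub>0/(m+1))\<close>.
\<close>

lemma H_unbounded: "\<exists>\<tau>. 0 < \<tau> \<and> \<tau> \<le> \<tau>\<^sub>0 \<and> y \<le> H \<mu> \<tau>\<^sub>0 \<tau>"
proof (rule ccontr)
  assume *: "\<not> ?thesis"
  have bound: "H \<mu> \<tau>\<^sub>0 \<tau> < y" if "0 < \<tau>" "\<tau> \<le> \<tau>\<^sub>0" for \<tau>
    using * that by (meson not_le)
  define a where "a m = \<tau>\<^sub>0 / real (Suc m)" for m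
  have a: "0 < a m" "a m \<le> \<tau>\<^sub>0" for m
    using \<tau>\<^sub>0 by (auto simp: a_def field_simps)
  define f where "f m \<sigma> = ennreal (\<mu> \<sigma> / \<sigma>) * indicator {a m..\<tau>\<^sub>0} \<sigma>" for m \<sigma>
  have int: "(\<integral>\<^sup>+\<sigma>. f m \<sigma> \<partial>lborel) = ennreal (H \<mu> \<tau>\<^sub>0 (a m))" for m
    unfolding f_def H_def
  proof (rule nn_integral_has_integral_lebesgue')
    show "((\<lambda>\<sigma>. \<mu> \<sigma> / \<sigma>) has_integral integral {a m..\<tau>\<^sub>0} (\<lambda>\<sigma>. \<mu> \<sigma> / \<sigma>)) {a m..\<tau>\<^sub>0}"
      using a by (intro integrable_integral integrable_continuous_real H_integrand_continuous)
    show "0 \<le> \<mu> \<sigma> / \<sigma>" if "\<sigma> \<in> {a m..\<tau>\<^sub>0}" for \<sigma>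
      using that a[of m] modulus_pos[of \<sigma>] by auto
  qed
  have meas: "f m \<in> borel_measurable lborel" for m
  proof -
    have "(\<lambda>\<sigma>. indicator {a m..\<tau>\<^sub>0} \<sigma> *\<^sub>R (\<mu> \<sigma> / \<sigma>)) \<in> borel_measurable borel"
      using a by (intro borel_measurable_continuous_on_indicator H_integrand_continuous) auto
    then have "(\<lambda>\<sigma>. ennreal (indicator {a m..\<tau>\<^sub>0} \<sigma> *\<^sub>R (\<mu> \<sigma> / \<sigma>))) \<in> borel_measurable lborel"
      by simp
    also have "(\<lambda>\<sigma>. ennreal (indicator {a m..\<tau>\<^sub>0} \<sigma> *\<^sub>R (\<mu> \<sigma> / \<sigma>))) = f m"
      by (auto simp: f_def fun_eq_iff split: split_indicator)
    finally show ?thesis .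
  qed
  have mono: "incseq f"
  proof (rule incseq_SucI, rule le_funI)
    fix m \<sigma>
    have "a (Suc m) \<le> a m" using \<tau>\<^sub>0 by (auto simp: a_def field_simps)
    then show "f m \<sigma> \<le> f (Suc m) \<sigma>" by (auto simp: f_def split: split_indicator)
  qed
  have sup: "(SUP m. f m \<sigma>) = ennreal (\<mu> \<sigma> / \<sigma>) * indicator {0<..\<tau>\<^sub>0} \<sigma>" for \<sigma>
  proof (cases "\<sigma> \<in> {0<..\<tau>\<^sub>0}")
    case True
    then obtain m where "inverse (real (Suc m)) < \<sigma> / \<tau>\<^sub>0"
      using reals_Archimedean[of "\<sigma> / \<tau>\<^sub>0"] \<tau>\<^sub>0 by auto
    then have "a m \<le> \<sigma>" using \<tau>\<^sub>0 by (simp add: a_def field_simps)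
    then have "f m \<sigma> = ennreal (\<mu> \<sigma> / \<sigma>)" using True by (simp add: f_def)
    moreover have "f j \<sigma> \<le> ennreal (\<mu> \<sigma> / \<sigma>)" for j by (simp add: f_def split: split_indicator)
    ultimately have "(SUP m. f m \<sigma>) = ennreal (\<mu> \<sigma> / \<sigma>)"
      by (intro antisym SUP_least) (auto intro: SUP_upper2[of m])
    then show ?thesis using True by simp
  next
    case False
    then have "f m \<sigma> = 0" for m using a[of m] by (auto simp: f_def split: split_indicator)
    then show ?thesis using False by simp
  qed
  have "(\<integral>\<^sup>+\<sigma>\<in>{0<..\<tau>\<^sub>0}. ennreal (\<mu> \<sigma> / \<sigma>) \<partial>lborel) = (SUP m. \<integral>\<^sup>+\<sigma>. f m \<sigma> \<partial>lborel)"
    using nn_integral_monotone_convergence_SUP[OF mono meas] by (simp add: sup)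
  also have "\<dots> \<le> ennreal y"
    unfolding int using bound a by (intro SUP_least ennreal_leI less_imp_le) auto
  finally have "dini_condition \<mu>"
    unfolding dini_condition_def using \<tau>\<^sub>0
    by (intro exI[of _ \<tau>\<^sub>0] conjI) (auto elim: le_less_trans)
  with not_dini show False by simp
qed

text \<open>
  \<open>H\<close> maps \<open>(0,\<tau>\<^sub>0]\<close> bijectively and decreasingly onto \<open>[0,\<infinity>)\<close>: it is strictly decreasing, 0 at \<open>\<tau>\<^sub>0\<close>,
  and unbounded. So an upper bound for \<open>H \<tau>\<close> is a lower bound for \<open>\<tau>\<close> in terms of \<open>H_inv\<close>.
\<close>

lemma H_inv_bounds:
  assumes "0 < \<tau>" "\<tau> \<le> \<tau>\<^sub>0" "H \<mu> \<tau>\<^sub>0 \<tau> \<le> y"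
  shows "0 < H_inv \<mu> \<tau>\<^sub>0 y" "H_inv \<mu> \<tau>\<^sub>0 y \<le> \<tau>"
proof -
  have inj: "inj_on (H \<mu> \<tau>\<^sub>0) {0<..\<tau>\<^sub>0}"
    by (rule linorder_inj_onI') (use H_strict_antimono in force)
  obtain \<delta> where \<delta>: "0 < \<delta>" "\<delta> \<le> \<tau>\<^sub>0" "y \<le> H \<mu> \<tau>\<^sub>0 \<delta>" using H_unbounded by blast
  have "\<delta> \<le> \<tau>"
    using H_strict_antimono[of \<tau> \<delta>] \<delta> assms by (cases "\<delta> \<le> \<tau>") auto
  moreover have "continuous_on {\<delta>..\<tau>} (H \<mu> \<tau>\<^sub>0)"
    by (rule continuous_on_subset[OF DERIV_continuous_on[OF H_has_derivative[OF \<delta>(1)]]]) (use assms in auto)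
  ultimately obtain \<sigma> where \<sigma>: "\<delta> \<le> \<sigma>" "\<sigma> \<le> \<tau>" "H \<mu> \<tau>\<^sub>0 \<sigma> = y"
    using IVT2'[of "H \<mu> \<tau>\<^sub>0" \<tau> y \<delta>] assms \<delta> by auto
  then have "H_inv \<mu> \<tau>\<^sub>0 y = \<sigma>"
    unfolding H_inv_def using the_inv_into_f_f[OF inj, of \<sigma>] \<delta> assms by auto
  then show "0 < H_inv \<mu> \<tau>\<^sub>0 y" "H_inv \<mu> \<tau>\<^sub>0 y \<le> \<tau>" using \<sigma> \<delta> by auto
qed

text \<open>
  With \<open>\<alpha> = 2/(n-1) = p - 1\<close>, \<open>\<beta> = 1/\<alpha>\<close> and \<open>m(t) = K t^\<beta>\<close> the factor \<open>m^(-\<alpha>)\<close> coming from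
  \<open>m F(y/(2m))\<close> equals \<open>K^(-\<alpha>)/t\<close>. Hence \<open>y^(-1-\<alpha>) y' \<ge> c \<mu>(\<sigma>(t))/t\<close>, and both sides are
  derivatives: of \<open>-y^(-\<alpha>)/\<alpha>\<close> on the left, and of \<open>\<alpha> c H(\<sigma>(t))\<close> on the right.
\<close>

lemma glassey_ode_bound:
  fixes y y' :: "real \<Rightarrow> real" and n :: nat
  assumes n: "2 \<le> n" and t\<^sub>0: "0 < t\<^sub>0" "t\<^sub>0 \<le> T" and K: "0 < K"
    and y: "\<And>t. t \<in> {t\<^sub>0..T} \<Longrightarrow> (y has_real_derivative y' t) (at t within {t\<^sub>0..T})"
    and lower: "0 < \<eta>" "\<And>t. t \<in> {t\<^sub>0..T} \<Longrightarrow> \<eta> \<le> y t"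
    and growth: "\<And>t. t \<in> {t\<^sub>0..T} \<Longrightarrow>
       K * t powr ((real n - 1) / 2) * nonlinearity n \<mu> (y t / (2 * (K * t powr ((real n - 1) / 2)))) \<le> y' t"
    and small: "\<eta> / (2 * K) * t\<^sub>0 powr (- (real n - 1) / 2) \<le> \<tau>\<^sub>0"
  shows "H \<mu> \<tau>\<^sub>0 (\<eta> / (2 * K) * T powr (- (real n - 1) / 2)) \<le>
      (real n - 1)\<^sup>2 / 4 * 2 powr p_Gla n * K powr (2 / (real n - 1)) * \<eta> powr (- 2 / (real n - 1))
      + H \<mu> \<tau>\<^sub>0 (\<eta> / (2 * K) * t\<^sub>0 powr (- (real n - 1) / 2))"
proof -
  define \<alpha> where "\<alpha> = 2 / (real n - 1)"
  define \<beta> where "\<beta> = (real n - 1) / 2"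
  have \<alpha>: "0 < \<alpha>" "\<beta> = 1 / \<alpha>" "0 < \<beta>" "\<alpha> * \<beta> = 1" using n by (auto simp: \<alpha>_def \<beta>_def)
  have exps: "- (real n - 1) / 2 = - \<beta>" "- 2 / (real n - 1) = - \<alpha>" "2 / (real n - 1) = \<alpha>"
    "(real n - 1)\<^sup>2 / 4 = \<beta>\<^sup>2" "(real n - 1) / 2 = \<beta>"
    by (simp_all only: \<alpha>_def \<beta>_def minus_divide_left power_divide) simp
  have p: "p_Gla n = 1 + \<alpha>" unfolding \<alpha>_def by (rule p_Gla_eq[OF n])
  define c where "c = 2 powr (- (1 + \<alpha>)) * K powr (- \<alpha>)"
  have c: "0 < c" using K by (simp add: c_def)
  define \<sigma> where "\<sigma> t = \<eta> / (2 * K) * t powr (- \<beta>)" for t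
  have \<sigma>: "0 < \<sigma> t" if "0 < t" for t using that K lower by (simp add: \<sigma>_def)
  have \<sigma>_anti: "\<sigma> t \<le> \<sigma> s" if "0 < s" "s \<le> t" for s t
    unfolding \<sigma>_def using that K lower \<alpha> by (intro mult_left_mono powr_mono2') auto
  have \<sigma>0: "\<sigma> t\<^sub>0 \<le> \<tau>\<^sub>0" using small unfolding exps \<sigma>_def .
  define h where "h = H \<mu> \<tau>\<^sub>0"
  \<comment> \<open>Nonincreasing by the separated differential inequality.\<close>
  define \<Psi> where "\<Psi> t = y t powr (- \<alpha>) / \<alpha> + \<alpha> * c * h (\<sigma> t)" for t
  define \<Psi>' where "\<Psi>' t = - (y t powr (- \<alpha> - 1) * y' t) + c * \<mu> (\<sigma> t) / t" for t
  have "\<Psi> T \<le> \<Psi> t\<^sub>0"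
  proof (rule nonincreasing_if_deriv_nonpos[where f = \<Psi> and f' = \<Psi>'])
    fix t assume t: "t \<in> {t\<^sub>0..T}"
    then have t0: "0 < t" using t\<^sub>0 by auto
    have y0: "0 < y t" using lower(1) lower(2)[OF t] by simp
    have "((\<lambda>t. y t powr (- \<alpha>)) has_real_derivative - \<alpha> * y t powr (- \<alpha> - 1) * y' t) (at t within {t\<^sub>0..T})"
      using DERIV_chain2[OF has_real_derivative_powr[OF y0, of "- \<alpha>"] y[OF t]] by simp
    moreover have "((\<lambda>t. h (\<sigma> t)) has_real_derivative \<beta> * \<mu> (\<sigma> t) / t) (at t within {t\<^sub>0..T})"
    proof -
      have "(\<sigma> has_real_derivative \<eta> / (2 * K) * (- \<beta> * t powr (- \<beta> - 1))) (at t within {t\<^sub>0..T})"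
        unfolding \<sigma>_def[abs_def]
        by (intro DERIV_cmult has_field_derivative_at_within[OF has_real_derivative_powr] t0)
      moreover have "t powr (- \<beta> - 1) = t powr (- \<beta>) / t" using t0 by (simp add: powr_diff)
      ultimately have "(\<sigma> has_real_derivative - \<beta> * \<sigma> t / t) (at t within {t\<^sub>0..T})"
        by (simp add: \<sigma>_def algebra_simps)
      moreover have "(h has_real_derivative - (\<mu> (\<sigma> t) / \<sigma> t)) (at (\<sigma> t) within \<sigma> ` {t\<^sub>0..T})"
      proof -
        have "\<sigma> ` {t\<^sub>0..T} \<subseteq> {\<sigma> T..\<tau>\<^sub>0}"
          using \<sigma>_anti t\<^sub>0 \<sigma>0 by (auto intro: order_trans[OF \<sigma>_anti])
        moreover from this t have "\<sigma> t \<in> {\<sigma> T..\<tau>\<^sub>0}" by blast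
        ultimately show ?thesis
          unfolding h_def using \<sigma>[of T] t\<^sub>0
          by (intro has_field_derivative_subset[OF H_has_derivative]) auto
      qed
      ultimately have "(h \<circ> \<sigma> has_real_derivative - (\<mu> (\<sigma> t) / \<sigma> t) * (- \<beta> * \<sigma> t / t)) (at t within {t\<^sub>0..T})"
        by (intro DERIV_image_chain)
      then show ?thesis using \<sigma>[OF t0] by (simp add: o_def mult.commute)
    qed
    ultimately have "((\<lambda>t. y t powr (- \<alpha>) / \<alpha> + \<alpha> * c * h (\<sigma> t)) has_real_derivative
        (- \<alpha> * y t powr (- \<alpha> - 1) * y' t) / \<alpha> + \<alpha> * c * (\<beta> * \<mu> (\<sigma> t) / t)) (at t within {t\<^sub>0..T})"
      by (intro DERIV_add DERIV_cdivide DERIV_cmult)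
    then show "(\<Psi> has_real_derivative \<Psi>' t) (at t within {t\<^sub>0..T})"
      unfolding \<Psi>_def[abs_def] \<Psi>'_def using \<alpha>(1) by (simp add: \<alpha>(2))
  next
    fix t assume t: "t\<^sub>0 < t" "t \<le> T"
    then have t': "t \<in> {t\<^sub>0..T}" and t0: "0 < t" using t\<^sub>0 by auto
    have yt: "0 < y t" using lower(1) lower(2)[OF t'] by simp
    define m where "m = K * t powr \<beta>"
    have m: "0 < m" using K t0 by (simp add: m_def)
    have "\<sigma> t = \<eta> / (2 * m)" by (simp add: \<sigma>_def m_def powr_minus field_simps)
    also have "\<dots> \<le> y t / (2 * m)" using m lower(2)[OF t'] by (intro divide_right_mono) auto
    finally have \<mu>_le: "\<mu> (\<sigma> t) \<le> \<mu> (y t / (2 * m))"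
      using modulus \<sigma>[OF t0] by (auto simp: modulus_of_continuity_def mono_on_def)
    have scaling: "m * (y t / (2 * m)) powr (1 + \<alpha>) = y t powr (1 + \<alpha>) * (c / t)"
    proof -
      have "m powr \<alpha> = K powr \<alpha> * t"
        using K t0 \<alpha> by (simp add: m_def powr_mult powr_powr mult.commute)
      moreover have "c = 1 / (2 * 2 powr \<alpha> * K powr \<alpha>)"
        unfolding c_def powr_minus powr_add by (simp add: inverse_eq_divide)
      ultimately show ?thesis
        using m yt K t0 by (simp add: powr_divide powr_mult powr_add field_simps)
    qed
    have "y t powr (1 + \<alpha>) * (c / t) * \<mu> (\<sigma> t) \<le> (m * (y t / (2 * m)) powr (1 + \<alpha>)) * \<mu> (y t / (2 * m))"
      unfolding scaling by (rule mult_left_mono[OF \<mu>_le]) (use c t0 in simp)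
    also have "\<dots> \<le> y' t"
      using growth[OF t'] m yt by (simp add: nonlinearity_def p m_def \<beta>_def mult.assoc)
    finally have "y t powr (- \<alpha> - 1) * (y t powr (1 + \<alpha>) * (c / t) * \<mu> (\<sigma> t)) \<le> y t powr (- \<alpha> - 1) * y' t"
      by (intro mult_left_mono) auto
    moreover have "y t powr (- \<alpha> - 1) * y t powr (1 + \<alpha>) = 1"
      using yt by (simp flip: powr_add)
    ultimately show "\<Psi>' t \<le> 0" unfolding \<Psi>'_def by (simp flip: mult.assoc)
  qed (use t\<^sub>0 in auto)
  moreover have "0 \<le> y T powr (- \<alpha>) / \<alpha>" using \<alpha> by simp
  moreover have "y t\<^sub>0 powr (- \<alpha>) / \<alpha> \<le> \<eta> powr (- \<alpha>) / \<alpha>"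
    using lower(1) lower(2)[of t\<^sub>0] t\<^sub>0 \<alpha> by (intro divide_right_mono powr_mono2') auto
  ultimately have "\<alpha> * c * h (\<sigma> T) \<le> \<eta> powr (- \<alpha>) / \<alpha> + \<alpha> * c * h (\<sigma> t\<^sub>0)"
    unfolding \<Psi>_def by linarith
  then have "h (\<sigma> T) \<le> \<eta> powr (- \<alpha>) / (\<alpha> * (\<alpha> * c)) + h (\<sigma> t\<^sub>0)"
    using \<alpha>(1) c by (simp add: field_simps)
  also have "\<eta> powr (- \<alpha>) / (\<alpha> * (\<alpha> * c)) = \<beta>\<^sup>2 * 2 powr (1 + \<alpha>) * K powr \<alpha> * \<eta> powr (- \<alpha>)"
    using \<alpha>(1) K unfolding c_def \<alpha>(2) powr_minus by (simp add: field_simps power2_eq_square)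
  finally have "h (\<sigma> T) \<le> \<beta>\<^sup>2 * 2 powr (1 + \<alpha>) * K powr \<alpha> * \<eta> powr (- \<alpha>) + h (\<sigma> t\<^sub>0)" .
  then show ?thesis unfolding exps h_def \<sigma>_def p by simp
qed

end

section \<open>Upper bound for the lifespan\<close>

lemma eq_0_outside_supp_ball:
  assumes "supp f \<subseteq> ball 0 R" "R \<le> norm x"
  shows "f x = (0::real)"
proof (rule ccontr)
  assume "f x \<noteq> 0"
  then have "x \<in> supp f" unfolding supp_def using closure_subset by fastforce
  with assms show False by auto
qed

lemma scaled_half_root_power:
  assumes "0 < t" "0 < R" "1 \<le> n"
  shows "4 * R * (2 * sqrt (8 * R * t)) ^ (n - 1) =
    4 * R * (2 * sqrt (8 * R)) ^ (n - 1) * t powr ((real n - 1) / 2)"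
proof -
  have "sqrt t ^ (n - 1) = t powr ((real n - 1) / 2)"
    using assms by (simp add: powr_half_sqrt[symmetric] powr_realpow[symmetric] powr_powr of_nat_diff)
  then show ?thesis by (simp add: real_sqrt_mult power_mult_distrib)
qed

text \<open>
  The differential inequality applies to the average \<open>Y\<close> on \<open>[3R,T]\<close>, with \<open>\<eta> = \<epsilon> a\<close> as lower bound:
  this is the initial value of \<open>Y\<close>, and \<open>Y\<close> is nondecreasing. The strict inequality \<open>T < S\<close> makes
  \<open>[0,T]\<close> a compact part of the existence interval.
\<close>

lemma existence_time_bound:
  fixes n :: nat and R \<epsilon> T :: real and u0 u1 :: "real^'n \<Rightarrow> real" and u :: "real \<Rightarrow> real^'n \<Rightarrow> real"
  assumes n: "n = CARD('n)" "n \<ge> 2" and R: "R > 0" and \<epsilon>: "\<epsilon> > 0"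
    and supp: "supp u0 \<subseteq> ball 0 R" "supp u1 \<subseteq> ball 0 R"
    and a: "a = (LINT x|lborel. u1 x)" "a > 0"
    and \<mu>: "modulus_of_continuity \<mu>" "\<not> dini_condition \<mu>" and convex: "convex_on UNIV (nonlinearity n \<mu>)"
    and \<tau>\<^sub>0: "\<tau>\<^sub>0 > 0" and K: "4 * R * (2 * sqrt (8 * R)) ^ (n - 1) \<le> K"
    and small: "\<epsilon> * a / (2 * K) * (3 * R) powr (- (real n - 1) / 2) \<le> \<tau>\<^sub>0"
    and sol: "classical_solution (nonlinearity n \<mu>) (\<lambda>x. \<epsilon> * u0 x) (\<lambda>x. \<epsilon> * u1 x) S u"
    and T: "ereal T < S" "3 * R \<le> T"
  shows "H \<mu> \<tau>\<^sub>0 (\<epsilon> * a / (2 * K) * T powr (- (real n - 1) / 2)) \<le>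
      (real n - 1)\<^sup>2 / 4 * 2 powr p_Gla n * K powr (2 / (real n - 1)) * (\<epsilon> * a) powr (- 2 / (real n - 1))
      + H \<mu> \<tau>\<^sub>0 (\<epsilon> * a / (2 * K) * (3 * R) powr (- (real n - 1) / 2))"
proof -
  let ?F = "nonlinearity n \<mu>"
  have T0: "0 < T" using T R by simp
  obtain ut utt ux uxt uxx where w: "wave_solution T ?F u ut utt ux uxt uxx" and ut0: "ut 0 = (\<lambda>x. \<epsilon> * u1 x)"
    using classical_solution_imp_wave_solution[OF sol T0 T(1)] .
  interpret wave_solution T ?F u ut utt ux uxt uxx by (rule w)
  have data: "u 0 x = 0" "ut 0 x = 0" if "R \<le> norm x" for x
    using sol ut0 eq_0_outside_supp_ball[OF supp(1) that] eq_0_outside_supp_ball[OF supp(2) that]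
    by (auto simp: classical_solution_def)
  obtain Y Y' where Y0: "Y 0 = integral UNIV (ut 0)"
    and dY: "\<And>t. t \<in> {0..T} \<Longrightarrow> (Y has_real_derivative Y' t) (at t within {0..T})"
    and mono: "\<And>t. 0 < t \<Longrightarrow> t \<le> T \<Longrightarrow> 0 \<le> Y' t"
    and growth: "\<And>t m. 3 * R \<le> t \<Longrightarrow> t \<le> T \<Longrightarrow> 0 < Y t \<Longrightarrow>
       4 * R * (2 * sqrt (8 * R * t)) ^ (CARD('n) - 1) \<le> m \<Longrightarrow> m * ?F (Y t / (2 * m)) \<le> Y' t"
    by (rule outgoing_average_growth[OF R nonlinearity_linear_bound[OF \<mu>(1) n(2)]
          nonlinearity_nonneg[OF \<mu>(1)] convex]) (use data in blast)+
  have "integrable lborel u1"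
    using a not_integrable_integral_eq[of lborel u1] by fastforce
  then have "Y 0 = \<epsilon> * a"
    unfolding Y0 ut0 a by (simp add: integral_lborel)
  have lower: "\<epsilon> * a \<le> Y t" if t: "t \<in> {0..T}" for t
  proof -
    have "- Y t \<le> - Y 0"
      by (rule nonincreasing_if_deriv_nonpos[where f = "\<lambda>t. - Y t" and f' = "\<lambda>t. - Y' t"])
         (use t mono in \<open>auto intro!: DERIV_minus has_field_derivative_subset[OF dY]\<close>)
    with \<open>Y 0 = \<epsilon> * a\<close> show ?thesis by simp
  qed
  have \<epsilon>a: "0 < \<epsilon> * a" using \<epsilon> a by simp
  have K0: "0 < K" using K R by (smt (verit) mult_pos_pos real_sqrt_gt_zero zero_less_power)
  show ?thesis
  proof (rule glassey_ode_bound[OF \<mu> \<tau>\<^sub>0 n(2) _ T(2) K0 _ \<epsilon>a _ _ small, where y' = Y'])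
    fix t assume t: "t \<in> {3 * R..T}"
    then have t': "t \<in> {0..T}" "0 < t" using R by auto
    show "(Y has_real_derivative Y' t) (at t within {3 * R..T})"
      by (rule has_field_derivative_subset[OF dY[OF t'(1)]]) (use R in auto)
    show "\<epsilon> * a \<le> Y t" by (rule lower[OF t'(1)])
    have "4 * R * (2 * sqrt (8 * R * t)) ^ (n - 1) \<le> K * t powr ((real n - 1) / 2)"
      unfolding scaled_half_root_power[OF t'(2) R order_trans[OF one_le_numeral n(2)]]
      by (rule mult_right_mono[OF K]) simp
    then show "K * t powr ((real n - 1) / 2) * ?F (Y t / (2 * (K * t powr ((real n - 1) / 2)))) \<le> Y' t"
      using t lower[OF t'(1)] \<epsilon>a n by (intro growth) auto
  qed (use R in auto)
qed

theorem proposition2p1: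
  fixes n :: nat and R :: real and u1 :: "real^'n \<Rightarrow> real"
  assumes "n = CARD('n)" and "n \<ge> 2" and "R > 0"
    and "C1_on UNIV u1" and "compact (supp u1)" and "supp u1 \<subseteq> ball 0 R"
    and "(LINT x|lborel. u1 x) > 0"
  shows "\<exists>\<epsilon>\<^sub>0>0. \<forall>(u0 :: real^'n \<Rightarrow> real) (\<mu> :: real \<Rightarrow> real) (\<tau>\<^sub>0 :: real).
    C2_on UNIV u0 \<and> compact (supp u0) \<and> supp u0 \<subseteq> ball 0 R \<and>
    modulus_of_continuity \<mu> \<and> convex_on UNIV (nonlinearity n \<mu>) \<and> \<not> dini_condition \<mu> \<and> \<tau>\<^sub>0 > 0 \<longrightarrow>
    (\<exists>c1>0. \<exists>c2>0. \<exists>C>0. c2 * \<epsilon>\<^sub>0 \<le> \<tau>\<^sub>0 \<and>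
      (\<forall>\<epsilon>\<in>{0<..\<epsilon>\<^sub>0}.
        lifespan (nonlinearity n \<mu>) (\<lambda>x. \<epsilon> * u0 x) (\<lambda>x. \<epsilon> * u1 x)
        \<le> ereal (C * \<epsilon> powr (2 / (real n - 1)) *
            (H_inv \<mu> \<tau>\<^sub>0 (c1 * \<epsilon> powr (- 2 / (real n - 1)) + H \<mu> \<tau>\<^sub>0 (c2 * \<epsilon>)))
              powr (- 2 / (real n - 1)))))"
proof (rule exI[of _ "1::real"], rule conjI[OF zero_less_one], intro allI impI, elim conjE)
  fix u0 :: "real^'n \<Rightarrow> real" and \<mu> :: "real \<Rightarrow> real" and \<tau>\<^sub>0 :: real
  assume supp0: "supp u0 \<subseteq> ball 0 R"
    and \<mu>: "modulus_of_continuity \<mu>" "\<not> dini_condition \<mu>"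
    and convex: "convex_on UNIV (nonlinearity n \<mu>)" and \<tau>\<^sub>0: "\<tau>\<^sub>0 > 0"
  define a where "a = (LINT x|lborel. u1 x)"
  have a: "0 < a" using assms by (simp add: a_def)
  define \<alpha> where "\<alpha> = 2 / (real n - 1)"
  define \<beta> where "\<beta> = (real n - 1) / 2"
  have \<alpha>: "0 < \<alpha>" "0 < \<beta>" "\<alpha> * \<beta> = 1" using assms by (auto simp: \<alpha>_def \<beta>_def)
  have exps: "- (real n - 1) / 2 = - \<beta>" "- 2 / (real n - 1) = - \<alpha>" "2 / (real n - 1) = \<alpha>"
    by (simp_all only: \<alpha>_def \<beta>_def minus_divide_left)
  define q where "q = (3 * R) powr (- \<beta>)"
  have q: "0 < q" using assms by (simp add: q_def)
  \<comment> \<open>The first entry is the constant in the volume bound; the second one makes \<open>c2 \<le> \<tau>\<^sub>0\<close>.\<close>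
  define K where "K = max (4 * R * (2 * sqrt (8 * R)) ^ (n - 1)) (a * q / (2 * \<tau>\<^sub>0))"
  have "0 < a * q / (2 * \<tau>\<^sub>0)" using a q \<tau>\<^sub>0 by simp
  then have K0: "0 < K" unfolding K_def by linarith
  have "a * q / (2 * \<tau>\<^sub>0) \<le> K" by (simp add: K_def)
  then have c2_le: "a / (2 * K) * q \<le> \<tau>\<^sub>0" using K0 \<tau>\<^sub>0 by (simp add: field_simps)
  define c1 where "c1 = (real n - 1)\<^sup>2 / 4 * 2 powr p_Gla n * K powr \<alpha> * a powr (- \<alpha>)"
  define c2 where "c2 = a / (2 * K) * q"
  define C where "C = (a / (2 * K)) powr \<alpha>"
  have pos: "0 < c1" "0 < c2" "0 < C"
    using assms a K0 q by (simp_all add: c1_def c2_def C_def)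
  have bound: "lifespan (nonlinearity n \<mu>) (\<lambda>x. \<epsilon> * u0 x) (\<lambda>x. \<epsilon> * u1 x)
      \<le> ereal (C * \<epsilon> powr \<alpha> * (H_inv \<mu> \<tau>\<^sub>0 (c1 * \<epsilon> powr - \<alpha> + H \<mu> \<tau>\<^sub>0 (c2 * \<epsilon>))) powr - \<alpha>)"
    (is "_ \<le> ereal ?B") if \<epsilon>: "\<epsilon> \<in> {0<..1}" for \<epsilon>
  proof -
    let ?y = "c1 * \<epsilon> powr - \<alpha> + H \<mu> \<tau>\<^sub>0 (c2 * \<epsilon>)"
    define \<sigma> where "\<sigma> t = \<epsilon> * a / (2 * K) * t powr (- \<beta>)" for t
    have \<sigma>_start: "\<sigma> (3 * R) = c2 * \<epsilon>" by (simp add: \<sigma>_def c2_def q_def)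
    have "c2 * \<epsilon> \<le> c2 * 1" using pos \<epsilon> by (intro mult_left_mono) auto
    with c2_le have c2\<epsilon>: "c2 * \<epsilon> \<le> \<tau>\<^sub>0" by (simp add: c2_def)
    have time_le: "t \<le> ?B" if t: "3 * R \<le> t" and Ht: "H \<mu> \<tau>\<^sub>0 (\<sigma> t) \<le> ?y" for t
    proof -
      have t0: "0 < t" using t assms by simp
      have \<sigma>0: "0 < \<sigma> t" using \<epsilon> a K0 t0 by (simp add: \<sigma>_def)
      have "\<sigma> t \<le> \<sigma> (3 * R)"
        unfolding \<sigma>_def using \<epsilon> a K0 t assms \<alpha> by (intro mult_left_mono powr_mono2') auto
      then have "\<sigma> t \<le> \<tau>\<^sub>0" using c2\<epsilon> \<sigma>_start by simp
      from H_inv_bounds[OF \<mu> \<tau>\<^sub>0 \<sigma>0 this Ht]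
      have "\<sigma> t powr - \<alpha> \<le> H_inv \<mu> \<tau>\<^sub>0 ?y powr - \<alpha>"
        using \<alpha> by (intro powr_mono2') auto
      then have le_B: "C * \<epsilon> powr \<alpha> * \<sigma> t powr - \<alpha> \<le> ?B"
        using pos by (intro mult_left_mono) auto
      have \<sigma>_powr: "\<sigma> t powr - \<alpha> = (\<epsilon> * (a / (2 * K))) powr - \<alpha> * t"
      proof -
        have "\<sigma> t = (\<epsilon> * (a / (2 * K))) * t powr - \<beta>" by (simp add: \<sigma>_def)
        also have "\<dots> powr - \<alpha> = (\<epsilon> * (a / (2 * K))) powr - \<alpha> * (t powr - \<beta>) powr - \<alpha>"
          by (rule powr_mult)
        also have "(t powr - \<beta>) powr - \<alpha> = t"
          using t0 \<alpha> by (simp add: powr_powr mult.commute)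
        finally show ?thesis .
      qed
      have "C * \<epsilon> powr \<alpha> * (\<epsilon> * (a / (2 * K))) powr - \<alpha> = 1"
        unfolding C_def using \<epsilon> a K0 by (simp add: powr_mult powr_divide powr_minus field_simps)
      then have "C * \<epsilon> powr \<alpha> * \<sigma> t powr - \<alpha> = t"
        unfolding \<sigma>_powr by (simp only: mult.assoc[symmetric] mult_1)
      with le_B show ?thesis by simp
    qed
    \<comment> \<open>This covers the solutions that cease to exist before the growth estimate starts.\<close>
    have start_le: "3 * R \<le> ?B"
      by (rule time_le) (use pos \<sigma>_start in auto)
    show ?thesis
      unfolding lifespan_def
    proof (intro Sup_least, clarify)
      fix S u
      assume sol: "classical_solution (nonlinearity n \<mu>) (\<lambda>x. \<epsilon> * u0 x) (\<lambda>x. \<epsilon> * u1 x) S u"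
      show "S \<le> ereal ?B"
      proof (rule ccontr)
        assume "\<not> S \<le> ereal ?B"
        then obtain T where T: "?B < T" "ereal T < S"
          using ereal_dense2[of "ereal ?B" S] by (auto simp: not_le)
        have "H \<mu> \<tau>\<^sub>0 (\<sigma> T) \<le> (real n - 1)\<^sup>2 / 4 * 2 powr p_Gla n * K powr \<alpha> * (\<epsilon> * a) powr (- \<alpha>) + H \<mu> \<tau>\<^sub>0 (\<sigma> (3 * R))"
        proof -
          have "0 < \<epsilon>" "3 * R \<le> T" using \<epsilon> start_le T by auto
          moreover have "4 * R * (2 * sqrt (8 * R)) ^ (n - 1) \<le> K"
            unfolding K_def by (rule max.cobounded1)
          moreover have "\<epsilon> * a / (2 * K) * (3 * R) powr (- (real n - 1) / 2) \<le> \<tau>\<^sub>0"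
            using c2\<epsilon> unfolding exps \<sigma>_start[symmetric] \<sigma>_def .
          ultimately show ?thesis
            using existence_time_bound[OF assms(1-3) _ supp0 assms(6) a_def a \<mu> convex \<tau>\<^sub>0 _ _ sol T(2)]
            unfolding exps \<sigma>_def by blast
        qed
        also have "(\<epsilon> * a) powr - \<alpha> = \<epsilon> powr - \<alpha> * a powr - \<alpha>"
          using \<epsilon> a by (simp add: powr_mult)
        finally have "H \<mu> \<tau>\<^sub>0 (\<sigma> T) \<le> ?y"
          unfolding c1_def \<sigma>_start by (simp add: algebra_simps)
        with time_le[of T] start_le T show False by auto
      qed
    qed
  qed
  show "\<exists>c1>0. \<exists>c2>0. \<exists>C>0. c2 * 1 \<le> \<tau>\<^sub>0 \<and>
      (\<forall>\<epsilon>\<in>{0<..1}.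
        lifespan (nonlinearity n \<mu>) (\<lambda>x. \<epsilon> * u0 x) (\<lambda>x. \<epsilon> * u1 x)
        \<le> ereal (C * \<epsilon> powr (2 / (real n - 1)) *
            (H_inv \<mu> \<tau>\<^sub>0 (c1 * \<epsilon> powr (- 2 / (real n - 1)) + H \<mu> \<tau>\<^sub>0 (c2 * \<epsilon>)))
              powr (- 2 / (real n - 1))))"
    unfolding exps
    by (intro exI[of _ c1] exI[of _ c2] exI[of _ C] conjI)
       (use pos c2_le bound in \<open>simp_all add: c2_def\<close>)
qed

end
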